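(* Let $(\Omega,\Sigma_\Omega,\mu)$ be a measure space, let $\{B_\omega\}_{\omega\in\Omega}$ be a measurable family of Banach spaces over $(\Omega,\mu,V)$, let $K=K(\Omega)$ be a Köthe function space on $\Omega$, and let $\{P(\omega)\}_{\omega\in\Omega}$, $P(\omega)\in\mathcal L(B_\omega)$, be a measurable family of bounded linear operators. For a measurable section $f$ put $(Pf)(\omega)=P(\omega)[f(\omega)]$. Then $Pf\in\left(\int_\Omega^\oplus B_\omega\,d\mu\right)_K$ for every $f\in\left(\int_\Omega^\oplus B_\omega\,d\mu\right)_K$ if and only if $N(P)\in L^\infty(\Omega)$. In this case the induced operator $P:\left(\int_\Omega^\oplus B_\omega\,d\mu\right)_K\to\left(\int_\Omega^\oplus B_\omega\,d\mu\right)_K$ is bounded and $\|P\|=\operatorname{ess\,sup}_{\omega\in\Omega}N(P)(\omega)$.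
   Context: Measurable family of Banach spaces: Let $V$ be a vector space. A family of semi-norms $\{\|\cdot\|_\omega\}_{\omega\in\Omega}$ on $V$ is measurable if $\omega\mapsto\|v\|_\omega$ is measurable for each $v\in V$. $B_\omega$ is the completion of $V/\ker(\|\cdot\|_\omega)$ with respect to $\|\cdot\|_\omega$; the family $\{B_\omega\}$ is then called a measurable family of Banach spaces over $(\Omega,\mu,V)$. Sections and direct integral: A section is a map $f:\Omega\to\bigcup_\omega B_\omega$ with $f(\omega)\in B_\omega$ for all $\omega$. A simple section is one of the form $\sum_{k=1}^n\chi_{A_k}(\omega)v_k$ with $v_k\in V$ and $A_k\subset\Omega$ measurable. A section $f$ is measurable if there are simple sections $h_k$ with $h_k(\omega)\to f(\omega)$ in $B_\omega$ for a.e. $\omega$. The direct integral $\int_\Omega^\oplus B_\omega\,d\mu$ is the space of a.e.-equivalence classes of measurable sections. Köthe function space: a Banach space $(K,\|\cdot\|_K)$ of real-valued measurable functions on $\Omega$ modulo a.e. equality such that (i) $\chi_A\in K$ for every measurable $A$ of finite measure; (ii) every $f\in K$ is integrable over every measurable set of finite measure; (iii) if $g$ is measurable, $f\in K$ and $|g|\le|f|$ a.e., then $g\in K$ and $\|g\|_K\le\|f\|_K$. $K$-direct integral: $\left(\int_\Omega^\oplus B_\omega\,d\mu\right)_K$ is the Banach space of all $f\in\int_\Omega^\oplus B_\omega\,d\mu$ such that $\omega\mapsto\|f(\omega)\|_\omega$ belongs to $K$, with norm $\big\|\,\|f(\cdot)\|_\cdot\,\big\|_K$. Measurable family of bounded linear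 operators: a map $\omega\mapsto P(\omega)\in\mathcal L(B_\omega)$, defined for almost all $\omega$, such that (1) $\omega\mapsto P(\omega)v$ is a measurable section of $\{B_\omega\}$ for every $v\in V$; (2) $\|P(\omega)\|<\infty$ (operator norm) for a.e. $\omega$. Lattice supremum: for a family $\mathcal F$ of measurable functions on $\Omega$, $\bigvee\mathcal F$ is the (a.e. unique) measurable function such that $f\le\bigvee\mathcal F$ a.e. for every $f\in\mathcal F$, and if $g$ is measurable with $f\le g$ a.e. for all $f\in\mathcal F$, then $\bigvee\mathcal F\le g$ a.e. Random norm: $N(P)(\omega)=\bigvee\left\{\frac{\|P(\omega)v\|_\omega}{\|v\|_\omega}:v\in V\right\}$, where the quotient is taken to be $0$ whenever $\|v\|_\omega=0$.
   Formalization: The measure space is assumed localizable: semifinite, with all lattice suprema of measurable functions existing (every sigma-finite space qualifies). Over a point of infinite mass with K={0} and P the identity, the norm formula fails: ‖P‖=0 but ess sup N(P)=1. *)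

theory Defs
  imports "HOL-Analysis.Analysis" "HOL-Probability.Essential_Supremum"
begin

section \<open>Completion of a seminormed space\<close>

definition seminorm :: "('v::real_vector \<Rightarrow> real) \<Rightarrow> bool" where
  "seminorm p \<longleftrightarrow> (\<forall>x y. p (x + y) \<le> p x + p y) \<and> (\<forall>c x. p (c *\<^sub>R x) = \<bar>c\<bar> * p x)"

definition cauchy_seqs :: "('v::real_vector \<Rightarrow> real) \<Rightarrow> (nat \<Rightarrow> 'v) set" where
  "cauchy_seqs p = {x. \<forall>e>0. \<exists>N. \<forall>m\<ge>N. \<forall>n\<ge>N. p (x m - x n) < e}"

definition null_diff :: "('v::real_vector \<Rightarrow> real) \<Rightarrow> ((nat \<Rightarrow> 'v) \<times> (nat \<Rightarrow> 'v)) set" where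
  "null_diff p = {(x, y). x \<in> cauchy_seqs p \<and> y \<in> cauchy_seqs p
                     \<and> (\<lambda>n. p (x n - y n)) \<longlonglongrightarrow> 0}"

text \<open>
  The completion of \<open>V / ker p\<close>: Cauchy sequences in \<open>V\<close> modulo sequences that are null for \<open>p\<close>.
  Sequences that differ by elements of \<open>ker p\<close> are identified, so the passage to \<open>V / ker p\<close>
  is part of the construction, and \<open>compl_emb p\<close> is the composition
  \<open>V \<rightarrow> V / ker p \<rightarrow> completion\<close>.
  For varying \<open>p\<close> all these spaces are carriers inside the one type \<open>(nat \<Rightarrow> 'v) set\<close>.
\<close>

definition compl_space :: "('v::real_vector \<Rightarrow> real) \<Rightarrow> (nat \<Rightarrow> 'v) set set" where
  "compl_space p = cauchy_seqs p // null_diff p"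

definition compl_emb :: "('v::real_vector \<Rightarrow> real) \<Rightarrow> 'v \<Rightarrow> (nat \<Rightarrow> 'v) set" where
  "compl_emb p v = null_diff p `` {\<lambda>_. v}"

definition compl_add ::
    "('v::real_vector \<Rightarrow> real) \<Rightarrow> (nat \<Rightarrow> 'v) set \<Rightarrow> (nat \<Rightarrow> 'v) set \<Rightarrow> (nat \<Rightarrow> 'v) set" where
  "compl_add p X Y = (\<Union>x\<in>X. \<Union>y\<in>Y. null_diff p `` {\<lambda>n. x n + y n})"

definition compl_scale ::
    "('v::real_vector \<Rightarrow> real) \<Rightarrow> real \<Rightarrow> (nat \<Rightarrow> 'v) set \<Rightarrow> (nat \<Rightarrow> 'v) set" where
  "compl_scale p c X = (\<Union>x\<in>X. null_diff p `` {\<lambda>n. c *\<^sub>R x n})"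

definition compl_norm :: "('v::real_vector \<Rightarrow> real) \<Rightarrow> (nat \<Rightarrow> 'v) set \<Rightarrow> real" where
  "compl_norm p X = the_elem ((\<lambda>x. lim (\<lambda>n. p (x n))) ` X)"

definition compl_dist ::
    "('v::real_vector \<Rightarrow> real) \<Rightarrow> (nat \<Rightarrow> 'v) set \<Rightarrow> (nat \<Rightarrow> 'v) set \<Rightarrow> real" where
  "compl_dist p X Y = compl_norm p (compl_add p X (compl_scale p (- 1) Y))"

text \<open>Membership in \<open>\<L>(B)\<close> for \<open>B = compl_space p\<close>; finiteness of the operator norm is the
  last conjunct.\<close>

definition bounded_operator :: "('v::real_vector \<Rightarrow> real) \<Rightarrow> ((nat \<Rightarrow> 'v) set \<Rightarrow> (nat \<Rightarrow> 'v) set) \<Rightarrow> bool" where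
  "bounded_operator p T \<longleftrightarrow>
     (\<forall>X\<in>compl_space p. T X \<in> compl_space p) \<and>
     (\<forall>X\<in>compl_space p. \<forall>Y\<in>compl_space p. T (compl_add p X Y) = compl_add p (T X) (T Y)) \<and>
     (\<forall>c. \<forall>X\<in>compl_space p. T (compl_scale p c X) = compl_scale p c (T X)) \<and>
     (\<exists>C. \<forall>X\<in>compl_space p. compl_norm p (T X) \<le> C * compl_norm p X)"


section \<open>Measurable families, sections, operators\<close>

text \<open>
  Elements of direct integrals and of function spaces are handled through representatives, as for
  integrable functions in the library: a section is a function defined on all of the type whose
  value lies in the fibre \<open>compl_space (sn \<omega>)\<close> for almost every \<open>\<omega>\<close>.  All predicates below are
  invariant under changes on null sets.
\<close>

definition measurable_family :: "'w measure \<Rightarrow> ('w \<Rightarrow> 'v::real_vector \<Rightarrow> real) \<Rightarrow> bool" where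
  "measurable_family M sn \<longleftrightarrow>
     (\<forall>\<omega>\<in>space M. seminorm (sn \<omega>)) \<and> (\<forall>v. (\<lambda>\<omega>. sn \<omega> v) \<in> borel_measurable M)"

definition simple_section :: "'w measure \<Rightarrow> ('w \<Rightarrow> 'v::real_vector) \<Rightarrow> bool" where
  "simple_section M h \<longleftrightarrow>
     (\<exists>(n::nat) A v. (\<forall>k<n. A k \<in> sets M) \<and> h = (\<lambda>\<omega>. \<Sum>k<n. indicator (A k) \<omega> *\<^sub>R v k))"

definition measurable_section ::
    "'w measure \<Rightarrow> ('w \<Rightarrow> 'v::real_vector \<Rightarrow> real) \<Rightarrow> ('w \<Rightarrow> (nat \<Rightarrow> 'v) set) \<Rightarrow> bool" where
  "measurable_section M sn f \<longleftrightarrow>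
     (AE \<omega> in M. f \<omega> \<in> compl_space (sn \<omega>)) \<and>
     (\<exists>h. (\<forall>k::nat. simple_section M (h k)) \<and>
          (AE \<omega> in M. (\<lambda>k. compl_dist (sn \<omega>) (compl_emb (sn \<omega>) (h k \<omega>)) (f \<omega>)) \<longlonglongrightarrow> 0))"

definition measurable_operator_family ::
    "'w measure \<Rightarrow> ('w \<Rightarrow> 'v::real_vector \<Rightarrow> real) \<Rightarrow>
     ('w \<Rightarrow> (nat \<Rightarrow> 'v) set \<Rightarrow> (nat \<Rightarrow> 'v) set) \<Rightarrow> bool" where
  "measurable_operator_family M sn P \<longleftrightarrow>
     (AE \<omega> in M. bounded_operator (sn \<omega>) (P \<omega>)) \<and>
     (\<forall>v. measurable_section M sn (\<lambda>\<omega>. P \<omega> (compl_emb (sn \<omega>) v)))"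

definition pointwise_op :: "('w \<Rightarrow> 'b \<Rightarrow> 'b) \<Rightarrow> ('w \<Rightarrow> 'b) \<Rightarrow> 'w \<Rightarrow> 'b" where
  "pointwise_op P f = (\<lambda>\<omega>. P \<omega> (f \<omega>))"


section \<open>Koethe function spaces and direct integrals\<close>

text \<open>
  \<open>K\<close> is the set of all representatives and \<open>nK\<close> the norm as a function of the representative;
  by the last conjunct \<open>K\<close> and \<open>nK\<close> are invariant under equality almost everywhere.
\<close>

definition koethe_space :: "'w measure \<Rightarrow> ('w \<Rightarrow> real) set \<Rightarrow> (('w \<Rightarrow> real) \<Rightarrow> real) \<Rightarrow> bool" where
  "koethe_space M K nK \<longleftrightarrow>
     K \<subseteq> borel_measurable M \<and>
     (\<lambda>_. 0) \<in> K \<and>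
     (\<forall>f\<in>K. \<forall>g\<in>K. (\<lambda>\<omega>. f \<omega> + g \<omega>) \<in> K \<and> nK (\<lambda>\<omega>. f \<omega> + g \<omega>) \<le> nK f + nK g) \<and>
     (\<forall>c. \<forall>f\<in>K. (\<lambda>\<omega>. c * f \<omega>) \<in> K \<and> nK (\<lambda>\<omega>. c * f \<omega>) = \<bar>c\<bar> * nK f) \<and>
     (\<forall>f\<in>K. nK f = 0 \<longleftrightarrow> (AE \<omega> in M. f \<omega> = 0)) \<and>
     (\<forall>F::nat \<Rightarrow> 'w \<Rightarrow> real. (\<forall>n. F n \<in> K) \<and>
        (\<forall>e>0. \<exists>N. \<forall>m\<ge>N. \<forall>n\<ge>N. nK (\<lambda>\<omega>. F m \<omega> - F n \<omega>) < e) \<longrightarrow>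
        (\<exists>g\<in>K. (\<lambda>n. nK (\<lambda>\<omega>. F n \<omega> - g \<omega>)) \<longlonglongrightarrow> 0)) \<and>
     (\<forall>A\<in>sets M. emeasure M A < \<infinity> \<longrightarrow> indicator A \<in> K) \<and>
     (\<forall>f\<in>K. \<forall>A\<in>sets M. emeasure M A < \<infinity> \<longrightarrow> set_integrable M A f) \<and>
     (\<forall>f\<in>K. \<forall>g\<in>borel_measurable M. (AE \<omega> in M. \<bar>g \<omega>\<bar> \<le> \<bar>f \<omega>\<bar>) \<longrightarrow> g \<in> K \<and> nK g \<le> nK f)"

text \<open>
  The function \<open>\<omega> \<mapsto> \<parallel>f \<omega>\<parallel>\<close> of a measurable section is only almost everywhere equal to a
  measurable function, hence the detour over \<open>g\<close>; the value of \<open>K_norm\<close> does not depend on the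
  choice of \<open>g\<close>.
\<close>

definition K_direct_integral ::
    "'w measure \<Rightarrow> ('w \<Rightarrow> 'v::real_vector \<Rightarrow> real) \<Rightarrow> ('w \<Rightarrow> real) set \<Rightarrow> ('w \<Rightarrow> (nat \<Rightarrow> 'v) set) set" where
  "K_direct_integral M sn K =
     {f. measurable_section M sn f \<and> (\<exists>g\<in>K. AE \<omega> in M. compl_norm (sn \<omega>) (f \<omega>) = g \<omega>)}"

definition K_norm ::
    "'w measure \<Rightarrow> ('w \<Rightarrow> 'v::real_vector \<Rightarrow> real) \<Rightarrow> ('w \<Rightarrow> real) set \<Rightarrow> (('w \<Rightarrow> real) \<Rightarrow> real) \<Rightarrow>
     ('w \<Rightarrow> (nat \<Rightarrow> 'v) set) \<Rightarrow> real" where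
  "K_norm M sn K nK f = nK (SOME g. g \<in> K \<and> (AE \<omega> in M. compl_norm (sn \<omega>) (f \<omega>) = g \<omega>))"

text \<open>
  \<open>T\<close> induces a bounded linear operator on the space of almost everywhere classes of
  \<open>K_direct_integral M sn K\<close>.
\<close>

definition bounded_operator_K ::
    "'w measure \<Rightarrow> ('w \<Rightarrow> 'v::real_vector \<Rightarrow> real) \<Rightarrow> ('w \<Rightarrow> real) set \<Rightarrow> (('w \<Rightarrow> real) \<Rightarrow> real) \<Rightarrow>
     (('w \<Rightarrow> (nat \<Rightarrow> 'v) set) \<Rightarrow> 'w \<Rightarrow> (nat \<Rightarrow> 'v) set) \<Rightarrow> bool" where
  "bounded_operator_K M sn K nK T \<longleftrightarrow>
     (\<forall>f\<in>K_direct_integral M sn K. T f \<in> K_direct_integral M sn K) \<and>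
     (\<forall>f\<in>K_direct_integral M sn K. \<forall>g\<in>K_direct_integral M sn K.
        (AE \<omega> in M. f \<omega> = g \<omega>) \<longrightarrow> (AE \<omega> in M. T f \<omega> = T g \<omega>)) \<and>
     (\<forall>f\<in>K_direct_integral M sn K. \<forall>g\<in>K_direct_integral M sn K.
        AE \<omega> in M. T (\<lambda>\<omega>. compl_add (sn \<omega>) (f \<omega>) (g \<omega>)) \<omega> = compl_add (sn \<omega>) (T f \<omega>) (T g \<omega>)) \<and>
     (\<forall>c. \<forall>f\<in>K_direct_integral M sn K.
        AE \<omega> in M. T (\<lambda>\<omega>. compl_scale (sn \<omega>) c (f \<omega>)) \<omega> = compl_scale (sn \<omega>) c (T f \<omega>)) \<and>
     (\<exists>C. \<forall>f\<in>K_direct_integral M sn K. K_norm M sn K nK (T f) \<le> C * K_norm M sn K nK f)"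

text \<open>As for \<^const>\<open>onorm\<close>, the quotient \<open>0 / 0\<close> counts as \<open>0\<close>.\<close>

definition K_onorm ::
    "'w measure \<Rightarrow> ('w \<Rightarrow> 'v::real_vector \<Rightarrow> real) \<Rightarrow> ('w \<Rightarrow> real) set \<Rightarrow> (('w \<Rightarrow> real) \<Rightarrow> real) \<Rightarrow>
     (('w \<Rightarrow> (nat \<Rightarrow> 'v) set) \<Rightarrow> 'w \<Rightarrow> (nat \<Rightarrow> 'v) set) \<Rightarrow> real" where
  "K_onorm M sn K nK T =
     (SUP f\<in>K_direct_integral M sn K. K_norm M sn K nK (T f) / K_norm M sn K nK f)"


section \<open>Lattice suprema and the random norm\<close>

definition is_lattice_sup :: "'w measure \<Rightarrow> ('w \<Rightarrow> ennreal) set \<Rightarrow> ('w \<Rightarrow> ennreal) \<Rightarrow> bool" where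
  "is_lattice_sup M F s \<longleftrightarrow>
     s \<in> borel_measurable M \<and>
     (\<forall>f\<in>F. AE \<omega> in M. f \<omega> \<le> s \<omega>) \<and>
     (\<forall>g\<in>borel_measurable M. (\<forall>f\<in>F. AE \<omega> in M. f \<omega> \<le> g \<omega>) \<longrightarrow> (AE \<omega> in M. s \<omega> \<le> g \<omega>))"

definition lattice_Sup :: "'w measure \<Rightarrow> ('w \<Rightarrow> ennreal) set \<Rightarrow> 'w \<Rightarrow> ennreal" where
  "lattice_Sup M F = (SOME s. is_lattice_sup M F s)"

text \<open>
  Lattice suprema do not exist over every measure space.  Localizable measure spaces are those
  which are semifinite and over which they do; every sigma-finite measure space is localizable
  (lemma \<open>sigma_finite_localizable\<close> below).  The library's \<^locale>\<open>semifinite_measure\<close> does not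
  require the set of finite measure to have positive measure, hence the explicit first conjunct.
\<close>

definition localizable :: "'w measure \<Rightarrow> bool" where
  "localizable M \<longleftrightarrow>
     (\<forall>A\<in>sets M. emeasure M A = \<infinity> \<longrightarrow> (\<exists>B\<in>sets M. B \<subseteq> A \<and> 0 < emeasure M B \<and> emeasure M B < \<infinity>)) \<and>
     (\<forall>F\<subseteq>borel_measurable M. \<exists>s. is_lattice_sup M F s)"

text \<open>The convention that the quotient is \<open>0\<close> where \<open>sn \<omega> v = 0\<close> is \<open>x / 0 = 0\<close>.\<close>

definition random_norm ::
    "'w measure \<Rightarrow> ('w \<Rightarrow> 'v::real_vector \<Rightarrow> real) \<Rightarrow>
     ('w \<Rightarrow> (nat \<Rightarrow> 'v) set \<Rightarrow> (nat \<Rightarrow> 'v) set) \<Rightarrow> 'w \<Rightarrow> ennreal" where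
  "random_norm M sn P =
     lattice_Sup M (range (\<lambda>v \<omega>. ennreal (compl_norm (sn \<omega>) (P \<omega> (compl_emb (sn \<omega>) v)) / sn \<omega> v)))"

definition L_infinity :: "'w measure \<Rightarrow> ('w \<Rightarrow> ennreal) set" where
  "L_infinity M = {g \<in> borel_measurable M. \<exists>C::real. AE \<omega> in M. g \<omega> \<le> ennreal C}"


section \<open>Basic facts\<close>

text \<open>\<open>compl_space p\<close> with the operations above is indeed the completion: the operations are
  computed on representatives, \<open>V\<close> embeds with dense image and with \<open>p\<close> as induced seminorm,
  and the metric is complete.\<close>

context
  fixes p :: "'v::real_vector \<Rightarrow> real"
  assumes p: "seminorm p"
begin

lemma seminorm_triangle: "p (x + y) \<le> p x + p y"
  and seminorm_scale: "p (c *\<^sub>R x) = \<bar>c\<bar> * p x"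
  using p by (auto simp: seminorm_def)

lemma seminorm_zero: "p 0 = 0"
  using seminorm_scale[of 0 0] by simp

lemma seminorm_minus: "p (- x) = p x"
  using seminorm_scale[of "- 1" x] by simp

lemma seminorm_minus_commute: "p (x - y) = p (y - x)"
  using seminorm_minus[of "x - y"] by simp

lemma seminorm_nonneg: "0 \<le> p x"
  using seminorm_triangle[of x "- x"] by (simp add: seminorm_minus seminorm_zero)

lemma seminorm_triangle_sub: "p (x - z) \<le> p (x - y) + p (y - z)"
  using seminorm_triangle[of "x - y" "y - z"] by simp

lemma seminorm_abs_diff: "\<bar>p x - p y\<bar> \<le> p (x - y)"
  using seminorm_triangle[of "x - y" y] seminorm_triangle[of "y - x" x]
  by (simp add: seminorm_minus_commute abs_le_iff)

lemma cauchy_seqsD: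
  assumes "x \<in> cauchy_seqs p" "0 < e"
  obtains N where "\<And>m n. N \<le> m \<Longrightarrow> N \<le> n \<Longrightarrow> p (x m - x n) < e"
  using assms unfolding cauchy_seqs_def by blast

lemma cauchy_seqs_const: "(\<lambda>_. v) \<in> cauchy_seqs p"
  by (simp add: cauchy_seqs_def seminorm_zero)

lemma cauchy_seqs_add:
  assumes x: "x \<in> cauchy_seqs p" and y: "y \<in> cauchy_seqs p"
  shows "(\<lambda>n. x n + y n) \<in> cauchy_seqs p"
  unfolding cauchy_seqs_def
proof safe
  fix e :: real assume "0 < e"
  then have e: "0 < e / 2" by simp
  obtain N1 where N1: "\<And>m n. N1 \<le> m \<Longrightarrow> N1 \<le> n \<Longrightarrow> p (x m - x n) < e / 2"
    using cauchy_seqsD[OF x e] by blast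
  obtain N2 where N2: "\<And>m n. N2 \<le> m \<Longrightarrow> N2 \<le> n \<Longrightarrow> p (y m - y n) < e / 2"
    using cauchy_seqsD[OF y e] by blast
  show "\<exists>N. \<forall>m\<ge>N. \<forall>n\<ge>N. p (x m + y m - (x n + y n)) < e"
  proof (intro exI[of _ "max N1 N2"] allI impI)
    fix m n assume "max N1 N2 \<le> m" "max N1 N2 \<le> n"
    then show "p (x m + y m - (x n + y n)) < e"
      using N1[of m n] N2[of m n] seminorm_triangle[of "x m - x n" "y m - y n"]
      by (simp add: algebra_simps)
  qed
qed

lemma cauchy_seqs_scale:
  assumes x: "x \<in> cauchy_seqs p"
  shows "(\<lambda>n. c *\<^sub>R x n) \<in> cauchy_seqs p"
  unfolding cauchy_seqs_def
proof safe
  fix e :: real assume "0 < e"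
  then have e: "0 < e / (\<bar>c\<bar> + 1)" by simp
  obtain N where N: "\<And>m n. N \<le> m \<Longrightarrow> N \<le> n \<Longrightarrow> p (x m - x n) < e / (\<bar>c\<bar> + 1)"
    using cauchy_seqsD[OF x e] by blast
  show "\<exists>N. \<forall>m\<ge>N. \<forall>n\<ge>N. p (c *\<^sub>R x m - c *\<^sub>R x n) < e"
  proof (intro exI[of _ N] allI impI)
    fix m n assume "N \<le> m" "N \<le> n"
    then have "p (x m - x n) * (\<bar>c\<bar> + 1) < e"
      using N[of m n] by (simp add: pos_less_divide_eq)
    moreover have "p (c *\<^sub>R x m - c *\<^sub>R x n) = \<bar>c\<bar> * p (x m - x n)"
      by (metis scaleR_right_diff_distrib seminorm_scale)
    ultimately show "p (c *\<^sub>R x m - c *\<^sub>R x n) < e"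
      using seminorm_nonneg[of "x m - x n"] by (simp add: algebra_simps)
  qed
qed

lemma cauchy_seqs_convergent:
  assumes x: "x \<in> cauchy_seqs p"
  shows "convergent (\<lambda>n. p (x n))"
  unfolding Cauchy_convergent_iff[symmetric]
proof (rule metric_CauchyI)
  fix e :: real assume "0 < e"
  then obtain N where "\<And>m n. N \<le> m \<Longrightarrow> N \<le> n \<Longrightarrow> p (x m - x n) < e"
    using cauchy_seqsD[OF x] by blast
  then show "\<exists>N. \<forall>m\<ge>N. \<forall>n\<ge>N. dist (p (x m)) (p (x n)) < e"
    using seminorm_abs_diff by (metis dist_real_def le_less_trans)
qed

lemma equiv_null_diff: "equiv (cauchy_seqs p) (null_diff p)"
proof (rule equivI)
  show "null_diff p \<subseteq> cauchy_seqs p \<times> cauchy_seqs p"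
    by (auto simp: null_diff_def)
  show "refl_on (cauchy_seqs p) (null_diff p)"
    by (auto simp: refl_on_def null_diff_def seminorm_zero)
  show "sym (null_diff p)"
    by (auto simp: sym_def null_diff_def seminorm_minus_commute)
  show "trans (null_diff p)"
  proof (rule transI)
    fix x y z assume *: "(x, y) \<in> null_diff p" "(y, z) \<in> null_diff p"
    then have lim: "(\<lambda>n. p (x n - y n) + p (y n - z n)) \<longlonglongrightarrow> 0 + 0"
      by (intro tendsto_add) (auto simp: null_diff_def)
    have "(\<lambda>n. p (x n - z n)) \<longlonglongrightarrow> 0"
      by (rule tendsto_sandwich[OF _ _ tendsto_const lim[simplified]])
         (auto simp: seminorm_nonneg seminorm_triangle_sub)
    with * show "(x, z) \<in> null_diff p" by (simp add: null_diff_def)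
  qed
qed

lemma compl_space_cases:
  assumes "X \<in> compl_space p"
  obtains x where "x \<in> cauchy_seqs p" "X = null_diff p `` {x}"
  using assms unfolding compl_space_def by (rule quotientE)

lemma class_in_compl_space: "x \<in> cauchy_seqs p \<Longrightarrow> null_diff p `` {x} \<in> compl_space p"
  unfolding compl_space_def by (rule quotientI)

lemma compl_add_class:
  assumes "x \<in> cauchy_seqs p" "y \<in> cauchy_seqs p"
  shows "compl_add p (null_diff p `` {x}) (null_diff p `` {y}) = null_diff p `` {\<lambda>n. x n + y n}"
  unfolding compl_add_def
proof (rule UN_equiv_class2[OF equiv_null_diff equiv_null_diff _ assms], rule congruent2I')
  fix x x' y y' assume *: "(x, x') \<in> null_diff p" "(y, y') \<in> null_diff p"
  then have lim: "(\<lambda>n. p (x n - x' n) + p (y n - y' n)) \<longlonglongrightarrow> 0 + 0"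
    by (intro tendsto_add) (auto simp: null_diff_def)
  have "(\<lambda>n. p (x n + y n - (x' n + y' n))) \<longlonglongrightarrow> 0"
  proof (rule tendsto_sandwich[OF _ _ tendsto_const lim[simplified]])
    show "\<forall>\<^sub>F n in sequentially. p (x n + y n - (x' n + y' n)) \<le> p (x n - x' n) + p (y n - y' n)"
      using seminorm_triangle[of "x _ - x' _" "y _ - y' _"]
      by (intro always_eventually allI) (metis add_diff_add)
  qed (simp add: seminorm_nonneg)
  with * have "((\<lambda>n. x n + y n), (\<lambda>n. x' n + y' n)) \<in> null_diff p"
    by (auto simp: null_diff_def cauchy_seqs_add)
  then show "null_diff p `` {\<lambda>n. x n + y n} = null_diff p `` {\<lambda>n. x' n + y' n}"
    by (rule equiv_class_eq[OF equiv_null_diff])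
qed

lemma compl_scale_class:
  assumes "x \<in> cauchy_seqs p"
  shows "compl_scale p c (null_diff p `` {x}) = null_diff p `` {\<lambda>n. c *\<^sub>R x n}"
  unfolding compl_scale_def
proof (rule UN_equiv_class[OF equiv_null_diff _ assms], rule congruentI)
  fix x x' assume *: "(x, x') \<in> null_diff p"
  then have lim: "(\<lambda>n. \<bar>c\<bar> * p (x n - x' n)) \<longlonglongrightarrow> \<bar>c\<bar> * 0"
    by (intro tendsto_mult_left) (auto simp: null_diff_def)
  have "p (c *\<^sub>R x n - c *\<^sub>R x' n) = \<bar>c\<bar> * p (x n - x' n)" for n
    by (metis scaleR_right_diff_distrib seminorm_scale)
  with * lim have "((\<lambda>n. c *\<^sub>R x n), (\<lambda>n. c *\<^sub>R x' n)) \<in> null_diff p"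
    by (auto simp: null_diff_def cauchy_seqs_scale)
  then show "null_diff p `` {\<lambda>n. c *\<^sub>R x n} = null_diff p `` {\<lambda>n. c *\<^sub>R x' n}"
    by (rule equiv_class_eq[OF equiv_null_diff])
qed

lemma compl_norm_class:
  assumes x: "x \<in> cauchy_seqs p"
  shows "(\<lambda>n. p (x n)) \<longlonglongrightarrow> compl_norm p (null_diff p `` {x})"
proof -
  have eq: "lim (\<lambda>n. p (y n)) = lim (\<lambda>n. p (x n))" if y: "(x, y) \<in> null_diff p" for y
  proof -
    have "(\<lambda>n. p (x n)) \<longlonglongrightarrow> lim (\<lambda>n. p (x n))"
      using cauchy_seqs_convergent[OF x] by (simp add: convergent_LIMSEQ_iff)
    moreover have "(\<lambda>n. p (y n) - p (x n)) \<longlonglongrightarrow> 0"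
    proof (rule Lim_null_comparison)
      show "\<forall>\<^sub>F n in sequentially. norm (p (y n) - p (x n)) \<le> p (x n - y n)"
        using seminorm_abs_diff by (simp add: seminorm_minus_commute[of "x _" "y _"])
    qed (use y in \<open>simp add: null_diff_def\<close>)
    ultimately have "(\<lambda>n. (p (y n) - p (x n)) + p (x n)) \<longlonglongrightarrow> 0 + lim (\<lambda>n. p (x n))"
      by (intro tendsto_add)
    then show ?thesis by (intro limI) simp
  qed
  have "(x, x) \<in> null_diff p"
    using x equiv_null_diff by (auto simp: equiv_def refl_on_def)
  then have "(\<lambda>y. lim (\<lambda>n. p (y n))) ` (null_diff p `` {x}) = {lim (\<lambda>n. p (x n))}"
    by (intro equalityI image_subsetI) (blast intro: eq)+
  then show ?thesis
    using cauchy_seqs_convergent[OF x] by (simp add: compl_norm_def convergent_LIMSEQ_iff)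
qed

lemma compl_dist_class:
  assumes "x \<in> cauchy_seqs p" "y \<in> cauchy_seqs p"
  shows "(\<lambda>n. p (x n - y n)) \<longlonglongrightarrow> compl_dist p (null_diff p `` {x}) (null_diff p `` {y})"
proof -
  note y = cauchy_seqs_scale[OF assms(2), of "- 1"]
  have "compl_dist p (null_diff p `` {x}) (null_diff p `` {y})
      = compl_norm p (null_diff p `` {\<lambda>n. x n + (- 1) *\<^sub>R y n})"
    unfolding compl_dist_def compl_scale_class[OF assms(2)] compl_add_class[OF assms(1) y] ..
  then show ?thesis
    using compl_norm_class[OF cauchy_seqs_add[OF assms(1) y]] by simp
qed

lemma compl_emb_in_compl_space: "compl_emb p v \<in> compl_space p"
  unfolding compl_emb_def by (intro class_in_compl_space cauchy_seqs_const)

lemma compl_norm_emb: "compl_norm p (compl_emb p v) = p v"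
  using compl_norm_class[OF cauchy_seqs_const] unfolding compl_emb_def
  by (rule LIMSEQ_unique) simp

lemma compl_dist_eq_0_iff:
  assumes "X \<in> compl_space p" "Y \<in> compl_space p"
  shows "compl_dist p X Y = 0 \<longleftrightarrow> X = Y"
proof -
  obtain x y where x: "x \<in> cauchy_seqs p" "X = null_diff p `` {x}"
    and y: "y \<in> cauchy_seqs p" "Y = null_diff p `` {y}"
    using assms compl_space_cases by metis
  have "X = Y \<longleftrightarrow> (x, y) \<in> null_diff p"
    using eq_equiv_class_iff[OF equiv_null_diff x(1) y(1)] by (simp add: x y)
  also have "\<dots> \<longleftrightarrow> compl_dist p X Y = 0"
    using compl_dist_class[OF x(1) y(1)] x y LIMSEQ_unique by (auto simp: null_diff_def)
  finally show ?thesis by simp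
qed

lemma compl_dist_triangle:
  assumes "X \<in> compl_space p" "Y \<in> compl_space p" "Z \<in> compl_space p"
  shows "compl_dist p X Z \<le> compl_dist p X Y + compl_dist p Y Z"
proof -
  obtain x y z where *: "x \<in> cauchy_seqs p" "X = null_diff p `` {x}"
    "y \<in> cauchy_seqs p" "Y = null_diff p `` {y}" "z \<in> cauchy_seqs p" "Z = null_diff p `` {z}"
    using assms compl_space_cases by metis
  show ?thesis
    unfolding * by (rule LIMSEQ_le[OF compl_dist_class tendsto_add[OF compl_dist_class compl_dist_class]])
      (auto simp: * intro: seminorm_triangle_sub)
qed

lemma compl_emb_close:
  assumes x: "x \<in> cauchy_seqs p" and N: "\<And>n. N \<le> n \<Longrightarrow> p (v - x n) \<le> e"
  shows "compl_dist p (compl_emb p v) (null_diff p `` {x}) \<le> e"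
  using compl_dist_class[OF cauchy_seqs_const x, of v] unfolding compl_emb_def[symmetric]
  by (rule LIMSEQ_le_const2) (use N in blast)

lemma compl_emb_dense:
  assumes "X \<in> compl_space p" "0 < e"
  obtains v where "compl_dist p (compl_emb p v) X \<le> e"
proof -
  obtain x where x: "x \<in> cauchy_seqs p" "X = null_diff p `` {x}"
    using assms compl_space_cases by metis
  obtain N where "\<And>m n. N \<le> m \<Longrightarrow> N \<le> n \<Longrightarrow> p (x m - x n) < e"
    using cauchy_seqsD[OF x(1) assms(2)] by blast
  then have "compl_dist p (compl_emb p (x N)) X \<le> e"
    unfolding x by (intro compl_emb_close[OF x(1), of N] less_imp_le) auto
  with that show ?thesis .
qed

lemma compl_dist_commute:
  assumes "X \<in> compl_space p" "Y \<in> compl_space p"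
  shows "compl_dist p X Y = compl_dist p Y X"
proof -
  obtain x y where *: "x \<in> cauchy_seqs p" "X = null_diff p `` {x}"
    "y \<in> cauchy_seqs p" "Y = null_diff p `` {y}"
    using assms compl_space_cases by metis
  show ?thesis
    using compl_dist_class[OF *(1,3)] compl_dist_class[OF *(3,1)]
    by (subst (asm) seminorm_minus_commute) (simp add: * LIMSEQ_unique)
qed

lemma compl_space_complete:
  assumes X: "\<And>n. X n \<in> compl_space p"
    and cauchy: "\<And>e. 0 < e \<Longrightarrow> \<exists>N. \<forall>m\<ge>N. \<forall>n\<ge>N. compl_dist p (X m) (X n) < e"
  shows "\<exists>Y\<in>compl_space p. (\<lambda>n. compl_dist p (X n) Y) \<longlonglongrightarrow> 0"
proof -
  define d where "d n = inverse (real (Suc n))" for n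
  have d: "d \<longlonglongrightarrow> 0" "\<And>n. 0 < d n"
    unfolding d_def using LIMSEQ_inverse_real_of_nat by simp_all
  have "\<exists>v. compl_dist p (compl_emb p v) (X n) \<le> d n" for n
    using compl_emb_dense[OF X d(2)] by blast
  then obtain y where y: "\<And>n. compl_dist p (compl_emb p (y n)) (X n) \<le> d n" by metis
  note E = compl_emb_in_compl_space
  have emb_dist: "compl_dist p (compl_emb p u) (compl_emb p v) = p (u - v)" for u v
    using compl_dist_class[OF cauchy_seqs_const cauchy_seqs_const] unfolding compl_emb_def
    by (rule LIMSEQ_unique) simp
  have dist: "p (y m - y n) \<le> d m + compl_dist p (X m) (X n) + d n" for m n
    using compl_dist_triangle[OF E[of "y m"] X[of m] E[of "y n"]]
      compl_dist_triangle[OF X[of m] X[of n] E[of "y n"]] compl_dist_commute[OF E[of "y n"] X[of n]] y[of m] y[of n]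
    by (simp add: emb_dist)
  have yc: "y \<in> cauchy_seqs p"
    unfolding cauchy_seqs_def
  proof safe
    fix e :: real assume e: "0 < e"
    obtain N1 where N1: "\<And>m n. N1 \<le> m \<Longrightarrow> N1 \<le> n \<Longrightarrow> compl_dist p (X m) (X n) < e / 3"
      using cauchy[of "e / 3"] e by auto
    obtain N2 where N2: "\<And>n. N2 \<le> n \<Longrightarrow> d n < e / 3"
      using order_tendstoD(2)[OF d(1), of "e / 3"] e by (auto simp: eventually_sequentially)
    show "\<exists>N. \<forall>m\<ge>N. \<forall>n\<ge>N. p (y m - y n) < e"
    proof (intro exI[of _ "max N1 N2"] allI impI)
      fix m n assume "max N1 N2 \<le> m" "max N1 N2 \<le> n"
      then show "p (y m - y n) < e"
        using dist[of m n] N1[of m n] N2[of m] N2[of n] by simp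
    qed
  qed
  let ?Y = "null_diff p `` {y}"
  have Y: "?Y \<in> compl_space p" by (rule class_in_compl_space[OF yc])
  have nonneg: "0 \<le> compl_dist p (X n) ?Y" for n
    using compl_dist_triangle[OF X[of n] Y X[of n]] compl_dist_commute[OF X[of n] Y]
      compl_dist_eq_0_iff[OF X[of n] X[of n]] by simp
  have "(\<lambda>n. compl_dist p (X n) ?Y) \<longlonglongrightarrow> 0"
  proof (rule LIMSEQ_I)
    fix e :: real assume e: "0 < e"
    then have e3: "0 < e / 3" by simp
    obtain N1 where N1: "\<And>m n. N1 \<le> m \<Longrightarrow> N1 \<le> n \<Longrightarrow> p (y m - y n) < e / 3"
      using cauchy_seqsD[OF yc e3] by blast
    obtain N2 where N2: "\<And>n. N2 \<le> n \<Longrightarrow> d n < e / 3"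
      using order_tendstoD(2)[OF d(1) e3] by (auto simp: eventually_sequentially)
    show "\<exists>N. \<forall>n\<ge>N. norm (compl_dist p (X n) ?Y - 0) < e"
    proof (intro exI[of _ "max N1 N2"] allI impI)
      fix n assume n: "max N1 N2 \<le> n"
      have "compl_dist p (compl_emb p (y n)) ?Y \<le> e / 3"
        using n N1 by (intro compl_emb_close[OF yc, of N1] less_imp_le) auto
      then show "norm (compl_dist p (X n) ?Y - 0) < e"
        using compl_dist_triangle[OF X[of n] E[of "y n"] Y] compl_dist_commute[OF E[of "y n"] X[of n]]
          y[of n] N2[of n] n e nonneg[of n] by simp
    qed
  qed
  with Y show ?thesis by blast
qed

end

text \<open>Over a sigma-finite measure, lattice suprema are suprema of countable subfamilies.\<close>

lemma ennreal_inverse_antimono: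
  fixes x y :: ennreal
  assumes "x \<le> y" shows "inverse y \<le> inverse x"
proof (cases "y = top \<or> x = 0")
  case True
  then show ?thesis by auto
next
  case False
  with assms have "x \<noteq> top" "y \<noteq> top" by (auto simp: top_unique)
  with False assms obtain a b where "x = ennreal a" "y = ennreal b" "0 < a" "a \<le> b"
    by (cases x; cases y) (auto simp: ennreal_le_iff2 less_le)
  then show ?thesis
    by (auto simp: inverse_ennreal le_imp_inverse_le intro!: ennreal_leI)
qed

lemma ennreal_inverse_inverse: "inverse (inverse x) = (x::ennreal)"
proof (cases "x = top \<or> x = 0")
  case False
  then obtain a where "x = ennreal a" "0 < a"
    by (cases x) (auto simp: less_le)
  then show ?thesis by (simp add: inverse_ennreal)
qed auto

lemma sigma_finite_localizable:
  assumes "sigma_finite_measure M"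
  shows "localizable M"
  unfolding localizable_def
proof (intro conjI ballI allI impI)
  interpret sigma_finite_measure M by fact
  fix A assume A: "A \<in> sets M" "emeasure M A = \<infinity>"
  have "\<exists>B\<in>sets M. B \<subseteq> A \<and> emeasure M B < \<infinity> \<and> emeasure M B > 1"
    using approx_PInf_emeasure_with_finite[OF A, of 1] by (metis ennreal_1)
  then show "\<exists>B\<in>sets M. B \<subseteq> A \<and> 0 < emeasure M B \<and> emeasure M B < \<infinity>"
    by (meson less_trans zero_less_one)
next
  interpret sigma_finite_measure M by fact
  fix F :: "('a \<Rightarrow> ennreal) set" assume F: "F \<subseteq> borel_measurable M"
  obtain w where w[measurable]: "w \<in> borel_measurable M" and wfin: "integral\<^sup>N M w \<noteq> \<infinity>"
    and wpos: "\<And>x. x \<in> space M \<Longrightarrow> 0 < w x \<and> w x < \<infinity>"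
    using Ex_finite_integrable_function by blast
  define J where "J s = (\<integral>\<^sup>+x. w x * inverse (1 + s x) \<partial>M)" for s :: "'a \<Rightarrow> ennreal"
  have inv_le: "inverse (1 + t) \<le> (1::ennreal)" for t
    using ennreal_inverse_antimono[of 1 "1 + t"] by simp
  have Jfin: "J s \<noteq> \<infinity>" for s
  proof -
    have "J s \<le> integral\<^sup>N M w"
      unfolding J_def using mult_left_mono[OF inv_le] by (intro nn_integral_mono) fastforce
    then show ?thesis using wfin by (auto simp: top_unique)
  qed
  define S where "S C = (\<lambda>x. SUP f\<in>C. f x)" for C :: "('a \<Rightarrow> ennreal) set"
  have Smeas: "S C \<in> borel_measurable M" if "countable C" "C \<subseteq> F" for C
    unfolding S_def using that F by (intro borel_measurable_SUP) auto
  define Cs where "Cs = {C. countable C \<and> C \<subseteq> F}"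
  have "J ` S ` Cs \<noteq> {}" by (auto simp: Cs_def)
  from ennreal_Inf_countable_INF[OF this] obtain j :: "nat \<Rightarrow> ennreal"
    where j: "range j \<subseteq> J ` S ` Cs" "Inf (J ` S ` Cs) = (INF i. j i)" by metis
  then have "\<forall>i. \<exists>C\<in>Cs. j i = J (S C)" by fastforce
  then obtain C where C: "\<And>i. C i \<in> Cs" "\<And>i. j i = J (S (C i))" by metis
  define D where "D = (\<Union>i. C i)"
  have D: "countable D" "D \<subseteq> F" "D \<in> Cs" using C(1) by (auto simp: D_def Cs_def)
  have Jmono: "J (S B) \<le> J (S A)" if "A \<subseteq> B" for A B
    unfolding J_def S_def using that
    by (intro nn_integral_mono mult_left_mono ennreal_inverse_antimono add_left_mono SUP_subset_mono) auto
  have Dmin: "J (S D) \<le> J (S B)" if "B \<in> Cs" for B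
  proof -
    have "J (S D) \<le> (INF i. j i)"
      unfolding C(2) by (intro INF_greatest Jmono) (auto simp: D_def)
    also have "\<dots> \<le> J (S B)" unfolding j(2)[symmetric] using that by (intro Inf_lower) auto
    finally show ?thesis .
  qed
  have "AE x in M. f x \<le> S D x" if f: "f \<in> F" for f
  proof -
    let ?E = "insert f D"
    have E: "?E \<in> Cs" using D f by (auto simp: Cs_def)
    have [measurable]: "S D \<in> borel_measurable M" "S ?E \<in> borel_measurable M"
      using Smeas D E by (auto simp: Cs_def)
    have DE: "S D x \<le> S ?E x" "f x \<le> S ?E x" for x
      unfolding S_def by (auto intro: SUP_subset_mono SUP_upper)
    have "AE x in M. w x * inverse (1 + S D x) \<le> w x * inverse (1 + S ?E x)"
    proof (rule ccontr)
      assume "\<not> ?thesis"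
      then have "J (S ?E) < J (S D)"
        unfolding J_def using Jfin[of "S ?E"] DE
        by (intro nn_integral_less)
           (auto simp: J_def intro!: AE_I2 mult_left_mono ennreal_inverse_antimono add_left_mono)
      with Dmin[OF E] show False by simp
    qed
    then show ?thesis
      using AE_space
    proof eventually_elim
      case (elim x)
      then have "inverse (1 + S D x) \<le> inverse (1 + S ?E x)"
        using wpos[of x] by (auto simp: ennreal_mult_le_mult_iff)
      then have "1 + S ?E x \<le> 1 + S D x"
        by (metis ennreal_inverse_antimono ennreal_inverse_inverse)
      then have "S ?E x \<le> S D x" by simp
      with DE(2)[of x] show ?case by order
    qed
  qed
  moreover have "AE x in M. S D x \<le> g x" if "\<forall>f\<in>F. AE x in M. f x \<le> g x" for g
  proof -
    have "AE x in M. \<forall>f\<in>D. f x \<le> g x"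
      using D that by (subst AE_ball_countable) auto
    then show ?thesis by eventually_elim (auto simp: S_def intro: SUP_least)
  qed
  ultimately show "\<exists>s. is_lattice_sup M F s"
    unfolding is_lattice_sup_def using Smeas[OF D(1,2)] by blast
qed

end

theory Submission
  imports Defs
begin

text \<open>
  A measurable section is the same as a section that is almost everywhere in the closure of a fixed
  countable subset of \<open>V\<close> and whose distance to every vector of \<open>V\<close> is measurable.  This
  description is stable under limits almost everywhere, over any measure space, so \<open>Pf\<close> is
  measurable as soon as \<open>f\<close> is, and the bound \<open>\<parallel>Pv\<parallel> \<le> C \<parallel>v\<parallel>\<close> passes from vectors to sections.
  Conversely, by semifiniteness a random norm exceeding \<open>c\<close> yields a vector \<open>v\<close> and a set \<open>A\<close> of
  positive finite measure on which \<open>\<parallel>Pv\<parallel> > c \<parallel>v\<parallel>\<close>.  The section \<open>\<chi>\<^sub>A v / \<parallel>v\<parallel>\<close> then shows that the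
  operator norm is at least \<open>c\<close>, and an infinite disjoint sum of such sections shows that \<open>P\<close> does
  not preserve the \<open>K\<close>-direct integral if the random norm is unbounded.
\<close>

section \<open>The completion of a seminormed space\<close>

context
  fixes p :: "'v::real_vector \<Rightarrow> real"
  assumes p: "seminorm p"
begin

lemma compl_add_closed:
  assumes "X \<in> compl_space p" "Y \<in> compl_space p"
  shows "compl_add p X Y \<in> compl_space p"
proof -
  obtain x y where *: "x \<in> cauchy_seqs p" "X = null_diff p `` {x}"
    "y \<in> cauchy_seqs p" "Y = null_diff p `` {y}"
    using assms compl_space_cases[OF p] by metis
  then show ?thesis
    by (simp add: compl_add_class[OF p] class_in_compl_space[OF p] cauchy_seqs_add[OF p])
qed

lemma compl_scale_closed:
  assumes "X \<in> compl_space p"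
  shows "compl_scale p c X \<in> compl_space p"
proof -
  obtain x where *: "x \<in> cauchy_seqs p" "X = null_diff p `` {x}"
    using assms compl_space_cases[OF p] by metis
  then show ?thesis
    by (simp add: compl_scale_class[OF p] class_in_compl_space[OF p] cauchy_seqs_scale[OF p])
qed

lemma compl_emb_scale: "compl_emb p (c *\<^sub>R v) = compl_scale p c (compl_emb p v)"
  unfolding compl_emb_def compl_scale_class[OF p cauchy_seqs_const[OF p]] ..

lemma compl_dist_nonneg:
  assumes "X \<in> compl_space p" "Y \<in> compl_space p"
  shows "0 \<le> compl_dist p X Y"
  using compl_dist_triangle[OF p assms(1,2,1)] compl_dist_commute[OF p assms]
    compl_dist_eq_0_iff[OF p assms(1,1)] by simp

lemma compl_dist_emb: "compl_dist p (compl_emb p u) (compl_emb p v) = p (u - v)"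
  using compl_dist_class[OF p cauchy_seqs_const[OF p] cauchy_seqs_const[OF p]] unfolding compl_emb_def
  by (rule LIMSEQ_unique) simp

text \<open>Turns norms into distances from an embedded vector, so that the later continuity and
  measurability results for such distances also cover norms.\<close>

lemma compl_norm_eq_dist:
  assumes "X \<in> compl_space p"
  shows "compl_norm p X = compl_dist p (compl_emb p 0) X"
proof -
  obtain x where x: "x \<in> cauchy_seqs p" "X = null_diff p `` {x}"
    using assms compl_space_cases[OF p] by metis
  show ?thesis
    using compl_dist_class[OF p cauchy_seqs_const[OF p] x(1), of 0] compl_norm_class[OF p x(1)] LIMSEQ_unique
    by (auto simp: x(2) compl_emb_def seminorm_minus[OF p])
qed

lemma compl_norm_nonneg: "X \<in> compl_space p \<Longrightarrow> 0 \<le> compl_norm p X"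
  by (simp add: compl_norm_eq_dist compl_dist_nonneg compl_emb_in_compl_space[OF p])

lemma compl_norm_scale:
  assumes "X \<in> compl_space p"
  shows "compl_norm p (compl_scale p c X) = \<bar>c\<bar> * compl_norm p X"
proof -
  obtain x where x: "x \<in> cauchy_seqs p" "X = null_diff p `` {x}"
    using assms compl_space_cases[OF p] by metis
  show ?thesis
    using compl_norm_class[OF p cauchy_seqs_scale[OF p x(1)], of c]
      tendsto_mult_left[OF compl_norm_class[OF p x(1)], of "\<bar>c\<bar>"] LIMSEQ_unique
    by (auto simp: x compl_scale_class[OF p] seminorm_scale[OF p])
qed

text \<open>By the triangle inequality the distance from \<open>X\<close> is 1-Lipschitz, so its
  values along \<open>Y\<close> differ from the limit by at most the distance of \<open>Y k\<close>
  to \<open>Z\<close>.\<close>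

lemma compl_dist_tendsto:
  assumes X: "X \<in> compl_space p" and Y: "\<And>k. Y k \<in> compl_space p" "Z \<in> compl_space p"
    and lim: "(\<lambda>k. compl_dist p (Y k) Z) \<longlonglongrightarrow> 0"
  shows "(\<lambda>k. compl_dist p X (Y k)) \<longlonglongrightarrow> compl_dist p X Z"
proof -
  have "\<bar>compl_dist p X (Y k) - compl_dist p X Z\<bar> \<le> compl_dist p (Y k) Z" for k
    using compl_dist_triangle[OF p X Y(1)[of k] Y(2)] compl_dist_triangle[OF p X Y(2) Y(1)[of k]]
      compl_dist_commute[OF p Y(1)[of k] Y(2)] by simp
  then have "(\<lambda>k. compl_dist p X (Y k) - compl_dist p X Z) \<longlonglongrightarrow> 0"
    by (intro Lim_null_comparison[OF _ lim]) simp
  then show ?thesis by (simp add: LIM_zero_iff)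
qed

lemma compl_norm_tendsto:
  assumes Y: "\<And>k. Y k \<in> compl_space p" "Z \<in> compl_space p"
    and lim: "(\<lambda>k. compl_dist p (Y k) Z) \<longlonglongrightarrow> 0"
  shows "(\<lambda>k. compl_norm p (Y k)) \<longlonglongrightarrow> compl_norm p Z"
  using compl_dist_tendsto[OF compl_emb_in_compl_space[OF p] assms, of 0]
  by (simp add: compl_norm_eq_dist Y)

section \<open>Continuity and homogeneity of bounded operators on the completion\<close>

lemma bounded_operator_closed:
  "bounded_operator p T \<Longrightarrow> X \<in> compl_space p \<Longrightarrow> T X \<in> compl_space p"
  by (simp add: bounded_operator_def)

lemma bounded_operator_bound:
  assumes "bounded_operator p T"
  obtains C where "\<And>X. X \<in> compl_space p \<Longrightarrow> compl_norm p (T X) \<le> C * compl_norm p X"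
  using assms unfolding bounded_operator_def by blast

text \<open>Additivity and homogeneity with factor \<open>- 1\<close> turn the difference of the
  images into the image of \<open>?D\<close>, so the operator bound becomes a Lipschitz bound for
  the distance.\<close>

lemma bounded_operator_tendsto:
  assumes T: "bounded_operator p T" and Y: "\<And>k. Y k \<in> compl_space p" "Z \<in> compl_space p"
    and lim: "(\<lambda>k. compl_dist p (Y k) Z) \<longlonglongrightarrow> 0"
  shows "(\<lambda>k. compl_dist p (T (Y k)) (T Z)) \<longlonglongrightarrow> 0"
proof -
  obtain C where C: "\<And>X. X \<in> compl_space p \<Longrightarrow> compl_norm p (T X) \<le> C * compl_norm p X"
    using bounded_operator_bound[OF T] by blast
  have "compl_dist p (T (Y k)) (T Z) \<le> C * compl_dist p (Y k) Z" for k
  proof -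
    let ?D = "compl_add p (Y k) (compl_scale p (- 1) Z)"
    have "compl_dist p (T (Y k)) (T Z) = compl_norm p (T ?D)"
      using T Y by (simp add: compl_dist_def bounded_operator_def compl_scale_closed)
    then show ?thesis
      using C[of ?D] Y by (simp add: compl_dist_def compl_add_closed compl_scale_closed)
  qed
  moreover have "0 \<le> compl_dist p (T (Y k)) (T Z)" for k
    by (intro compl_dist_nonneg bounded_operator_closed[OF T] Y)
  ultimately show ?thesis
    by (intro Lim_null_comparison[OF _ tendsto_mult_right_zero[OF lim, of C]]) simp
qed

lemma bounded_operator_scale_norm:
  assumes "bounded_operator p T" "X \<in> compl_space p"
  shows "compl_norm p (T (compl_scale p c X)) = \<bar>c\<bar> * compl_norm p (T X)"
  using assms by (simp add: bounded_operator_def compl_norm_scale)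

text \<open>Any bound \<open>C\<close> forces the norm below \<open>C * 0\<close>. This covers the
  vectors of seminorm zero, where the quotient in the random norm is 0 by convention and carries no
  information on the image.\<close>

lemma bounded_operator_norm_emb_zero:
  assumes T: "bounded_operator p T" and "p v = 0"
  shows "compl_norm p (T (compl_emb p v)) = 0"
proof -
  obtain C where "\<And>X. X \<in> compl_space p \<Longrightarrow> compl_norm p (T X) \<le> C * compl_norm p X"
    using bounded_operator_bound[OF T] by blast
  from this[OF compl_emb_in_compl_space[OF p], of v] assms(2) show ?thesis
    using compl_norm_nonneg[OF bounded_operator_closed[OF T compl_emb_in_compl_space[OF p], of v]]
    by (simp add: compl_norm_emb[OF p])
qed

end


section \<open>Measurable sections\<close>

text \<open>The measure may be incomplete and sections are constrained only almost everywhere, so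
  norms and distances of sections are measurable only after a change on a null set.\<close>

definition ae_measurable :: "'w measure \<Rightarrow> ('w \<Rightarrow> real) \<Rightarrow> bool" where
  "ae_measurable M f \<longleftrightarrow> (\<exists>g\<in>borel_measurable M. AE \<omega> in M. f \<omega> = g \<omega>)"

lemma ae_measurable_choice:
  assumes "\<And>i. ae_measurable M (F i)"
  shows "\<exists>g. \<forall>i. g i \<in> borel_measurable M \<and> (AE \<omega> in M. F i \<omega> = g i \<omega>)"
  by (rule choice) (use assms in \<open>unfold ae_measurable_def, blast\<close>)

lemma ae_measurable_limit:
  assumes F: "\<And>k::nat. ae_measurable M (F k)" and lim: "AE \<omega> in M. (\<lambda>k. F k \<omega>) \<longlonglongrightarrow> f \<omega>"
  shows "ae_measurable M f"
proof -
  obtain g where g: "\<And>k. g k \<in> borel_measurable M" "\<And>k. AE \<omega> in M. F k \<omega> = g k \<omega>"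
    using ae_measurable_choice[where F=F, OF F] by blast
  have "AE \<omega> in M. \<forall>k. F k \<omega> = g k \<omega>" using g(2) by (simp add: AE_all_countable)
  \<comment> \<open>\<open>lim\<close> is total, and \<open>lim (\<lambda>k. g k \<omega>)\<close>
    is Borel measurable in \<omega> on the whole space, including the points where the sequence
    diverges.\<close>
  with lim have "AE \<omega> in M. f \<omega> = lim (\<lambda>k. g k \<omega>)"
    by eventually_elim (simp add: limI)
  with g(1) show ?thesis unfolding ae_measurable_def by (intro bexI) measurable
qed

text \<open>The exceptional null set of \<open>G v\<close> depends on \<open>v\<close>, and there
  may be uncountably many \<open>v\<close>; a simple \<open>h\<close> takes only finitely many
  values, so finitely many null sets are discarded.\<close>

lemma ae_measurable_simple_function:
  assumes h: "simple_function M h" and G: "\<And>v. ae_measurable M (G v)"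
  shows "ae_measurable M (\<lambda>\<omega>. G (h \<omega>) \<omega>)"
proof -
  obtain g where g: "\<And>v. g v \<in> borel_measurable M" "\<And>v. AE \<omega> in M. G v \<omega> = g v \<omega>"
    using ae_measurable_choice[where F=G, OF G] by blast
  have fin: "finite (h ` space M)" using h by (simp add: simple_function_def)
  have "h \<in> measurable M (count_space (h ` space M))"
    using h by (auto simp: simple_function_def measurable_count_space_eq2)
  then have "(\<lambda>\<omega>. g (h \<omega>) \<omega>) \<in> borel_measurable M"
    using measurable_compose_countable'[where f=g and g=h, OF _ _ countable_finite[OF fin]] g(1) by blast
  moreover have "AE \<omega> in M. \<forall>v\<in>h ` space M. G v \<omega> = g v \<omega>"
    using fin g(2) by (intro AE_finite_allI)
  then have "AE \<omega> in M. G (h \<omega>) \<omega> = g (h \<omega>) \<omega>"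
    using AE_space by eventually_elim auto
  ultimately show ?thesis by (auto simp: ae_measurable_def)
qed

lemma simple_section_simple_function:
  assumes "simple_section M h"
  shows "simple_function M h"
proof -
  obtain n A v where A: "\<And>k. k < n \<Longrightarrow> A k \<in> sets M"
    and h: "h = (\<lambda>\<omega>. \<Sum>k<(n::nat). indicator (A k) \<omega> *\<^sub>R v k)"
    using assms unfolding simple_section_def by blast
  have "simple_function M (\<lambda>\<omega>. \<Sum>k<m. indicator (A k) \<omega> *\<^sub>R v k)" if "m \<le> n" for m
    using that
  proof (induction m)
    case (Suc m)
    have "simple_function M (indicator (A m) :: _ \<Rightarrow> real)" using Suc A by simp
    then have "simple_function M (\<lambda>\<omega>. indicator (A m) \<omega> *\<^sub>R v m)"
      by (rule simple_function_compose1)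
    with Suc show ?case
      by (simp add: simple_function_compose2[where h="(+)"])
  qed simp
  then show ?thesis by (simp add: h)
qed

lemma simple_function_simple_section:
  fixes h :: "'w \<Rightarrow> 'v::real_vector"
  assumes h: "simple_function M h"
  obtains h' where "simple_section M h'" "\<And>\<omega>. \<omega> \<in> space M \<Longrightarrow> h' \<omega> = h \<omega>"
proof -
  have fin: "finite (h ` space M)" using h by (simp add: simple_function_def)
  then obtain n v where v: "h ` space M = v ` {..<(n::nat)}" "inj_on v {..<n}"
    using finite_imp_nat_seg_image_inj_on[of "h ` space M"] by (auto simp: lessThan_def)
  \<comment> \<open>The level sets are disjoint because \<open>v\<close> is injective, so exactly
    one summand has coefficient 1 at a point of the space. Outside the space all indicators vanish,
    hence agreement is claimed only inside.\<close>
  define h' where "h' \<omega> = (\<Sum>k<n. indicator (h -` {v k} \<inter> space M) \<omega> *\<^sub>R v k)" for \<omega>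
  have "simple_section M h'"
    unfolding simple_section_def h'_def[abs_def]
    by (rule exI[of _ n], rule exI[of _ "\<lambda>k. h -` {v k} \<inter> space M"], rule exI[of _ v])
      (use h v in \<open>auto simp: simple_function_def\<close>)
  moreover have "h' \<omega> = h \<omega>" if \<omega>: "\<omega> \<in> space M" for \<omega>
  proof -
    obtain j where j: "j < n" "h \<omega> = v j" using v \<omega> by blast
    have "h' \<omega> = (\<Sum>k<n. if k = j then v j else 0)"
      unfolding h'_def using j \<omega> v(2) by (intro sum.cong) (auto simp: inj_on_def indicator_def)
    with j show ?thesis by simp
  qed
  ultimately show ?thesis by (rule that)
qed

section \<open>Measurable sections: distances, separability, gluing and limits\<close>

context
  fixes M :: "'w measure" and sn :: "'w \<Rightarrow> 'v::real_vector \<Rightarrow> real"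
  assumes fam: "measurable_family M sn"
begin

lemma AE_seminorm: "AE \<omega> in M. seminorm (sn \<omega>)"
  using fam by (auto simp: measurable_family_def)

lemma measurable_seminorm: "(\<lambda>\<omega>. sn \<omega> v) \<in> borel_measurable M"
  using fam by (auto simp: measurable_family_def)

lemma measurable_sectionI:
  assumes f: "AE \<omega> in M. f \<omega> \<in> compl_space (sn \<omega>)"
    and h: "\<And>k::nat. simple_function M (h k)"
    and lim: "AE \<omega> in M. (\<lambda>k. compl_dist (sn \<omega>) (compl_emb (sn \<omega>) (h k \<omega>)) (f \<omega>)) \<longlonglongrightarrow> 0"
  shows "measurable_section M sn f"
proof -
  have "\<exists>h'. \<forall>k. simple_section M (h' k) \<and> (\<forall>\<omega>\<in>space M. h' k \<omega> = h k \<omega>)"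
    by (intro choice allI) (blast intro: simple_function_simple_section[OF h])
  then obtain h' where h': "\<And>k. simple_section M (h' k)" "\<And>k \<omega>. \<omega> \<in> space M \<Longrightarrow> h' k \<omega> = h k \<omega>"
    by blast
  have "AE \<omega> in M. (\<lambda>k. compl_dist (sn \<omega>) (compl_emb (sn \<omega>) (h' k \<omega>)) (f \<omega>)) \<longlonglongrightarrow> 0"
    using lim AE_space by eventually_elim (simp add: h')
  with f h'(1) show ?thesis unfolding measurable_section_def by blast
qed

lemma measurable_sectionE:
  assumes "measurable_section M sn f"
  obtains h where "\<And>k::nat. simple_function M (h k)"
    "AE \<omega> in M. (\<lambda>k. compl_dist (sn \<omega>) (compl_emb (sn \<omega>) (h k \<omega>)) (f \<omega>)) \<longlonglongrightarrow> 0"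
  using assms unfolding measurable_section_def by (blast intro: simple_section_simple_function that)

lemma measurable_section_fibre:
  "measurable_section M sn f \<Longrightarrow> AE \<omega> in M. f \<omega> \<in> compl_space (sn \<omega>)"
  by (simp add: measurable_section_def)

text \<open>For an approximating simple section \<open>h k\<close> the distance is
  \<open>sn \<omega> (v - h k \<omega>)\<close>, which takes finitely many measurable branches; the
  distance to \<open>f\<close> is the limit of these.\<close>

lemma measurable_section_dist:
  assumes f: "measurable_section M sn f"
  shows "ae_measurable M (\<lambda>\<omega>. compl_dist (sn \<omega>) (compl_emb (sn \<omega>) v) (f \<omega>))"
proof -
  obtain h where h: "\<And>k::nat. simple_function M (h k)"
    and lim: "AE \<omega> in M. (\<lambda>k. compl_dist (sn \<omega>) (compl_emb (sn \<omega>) (h k \<omega>)) (f \<omega>)) \<longlonglongrightarrow> 0"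
    using measurable_sectionE[OF f] by blast
  have "AE \<omega> in M. (\<lambda>k. sn \<omega> (v - h k \<omega>)) \<longlonglongrightarrow> compl_dist (sn \<omega>) (compl_emb (sn \<omega>) v) (f \<omega>)"
    using lim AE_seminorm measurable_section_fibre[OF f]
  proof eventually_elim
    case (elim \<omega>)
    then show ?case
      using compl_dist_tendsto[OF elim(2) compl_emb_in_compl_space[OF elim(2)]
          compl_emb_in_compl_space[OF elim(2)] elim(3,1), of v]
      by (simp add: compl_dist_emb)
  qed
  moreover have "ae_measurable M (\<lambda>\<omega>. sn \<omega> (v - h k \<omega>))" for k
    by (rule ae_measurable_simple_function[OF h, where G="\<lambda>u \<omega>. sn \<omega> (v - u)"])
      (auto simp: ae_measurable_def intro: measurable_seminorm)
  ultimately show ?thesis by (intro ae_measurable_limit[where f="\<lambda>\<omega>. compl_dist (sn \<omega>) (compl_emb (sn \<omega>) v) (f \<omega>)"])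
qed

lemma measurable_section_norm:
  assumes f: "measurable_section M sn f"
  shows "ae_measurable M (\<lambda>\<omega>. compl_norm (sn \<omega>) (f \<omega>))"
proof -
  obtain g where g: "g \<in> borel_measurable M"
    "AE \<omega> in M. compl_dist (sn \<omega>) (compl_emb (sn \<omega>) 0) (f \<omega>) = g \<omega>"
    using measurable_section_dist[OF f] unfolding ae_measurable_def by blast
  have "AE \<omega> in M. compl_norm (sn \<omega>) (f \<omega>) = g \<omega>"
    using g(2) AE_seminorm measurable_section_fibre[OF f]
    by eventually_elim (simp add: compl_norm_eq_dist)
  with g(1) show ?thesis by (auto simp: ae_measurable_def)
qed

lemma measurable_section_separable:
  assumes f: "measurable_section M sn f"
  shows "\<exists>D. countable D \<and> (AE \<omega> in M. \<forall>e>0. \<exists>d\<in>D. compl_dist (sn \<omega>) (compl_emb (sn \<omega>) d) (f \<omega>) < e)"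
proof -
  obtain h where h: "\<And>k::nat. simple_function M (h k)"
    and lim: "AE \<omega> in M. (\<lambda>k. compl_dist (sn \<omega>) (compl_emb (sn \<omega>) (h k \<omega>)) (f \<omega>)) \<longlonglongrightarrow> 0"
    using measurable_sectionE[OF f] by blast
  \<comment> \<open>All values of all approximating simple functions: a countable union of finite
    sets.\<close>
  let ?D = "\<Union>k. h k ` space M"
  have "countable ?D"
    using h by (auto simp: simple_function_def intro: countable_finite)
  moreover have "AE \<omega> in M. \<forall>e>0. \<exists>d\<in>?D. compl_dist (sn \<omega>) (compl_emb (sn \<omega>) d) (f \<omega>) < e"
    using lim AE_space
  proof eventually_elim
    case (elim \<omega>)
    show ?case
    proof (intro allI impI)
      fix e :: real assume "0 < e"
      from order_tendstoD(2)[OF elim(1) this] obtain k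
        where "compl_dist (sn \<omega>) (compl_emb (sn \<omega>) (h k \<omega>)) (f \<omega>) < e"
        by (auto simp: eventually_sequentially)
      then show "\<exists>d\<in>?D. compl_dist (sn \<omega>) (compl_emb (sn \<omega>) d) (f \<omega>) < e"
        using elim(2) by blast
    qed
  qed
  ultimately show ?thesis by blast
qed

text \<open>Picking the best approximant among the first \<open>n\<close> points of the countable set is a simple
  section, so no sigma-finiteness is needed.\<close>

lemma measurable_section_separableI:
  assumes f: "AE \<omega> in M. f \<omega> \<in> compl_space (sn \<omega>)"
    and D: "countable D" "AE \<omega> in M. \<forall>e>0. \<exists>d\<in>D. compl_dist (sn \<omega>) (compl_emb (sn \<omega>) d) (f \<omega>) < e"
    and dist: "\<And>v. ae_measurable M (\<lambda>\<omega>. compl_dist (sn \<omega>) (compl_emb (sn \<omega>) v) (f \<omega>))"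
  shows "measurable_section M sn f"
proof -
  \<comment> \<open>Inserting 0 makes the set nonempty, so that \<open>d\<close> enumerates exactly
    this set even if \<open>D\<close> is empty.\<close>
  define d where "d = from_nat_into (insert 0 D)"
  have range_d: "range d = insert 0 D"
    using D(1) by (simp add: d_def range_from_nat_into)
  obtain G where G[measurable]: "\<And>i. G i \<in> borel_measurable M"
    and eq: "\<And>i. AE \<omega> in M. compl_dist (sn \<omega>) (compl_emb (sn \<omega>) (d i)) (f \<omega>) = G i \<omega>"
    using ae_measurable_choice[where F="\<lambda>i \<omega>. compl_dist (sn \<omega>) (compl_emb (sn \<omega>) (d i)) (f \<omega>)", OF dist]
    by blast
  define I where "I n \<omega> = (LEAST i. i \<le> n \<and> (\<forall>j\<in>{..n}. G i \<omega> \<le> G j \<omega>))" for n \<omega>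
  have I: "I n \<omega> \<le> n \<and> (\<forall>j\<in>{..n}. G (I n \<omega>) \<omega> \<le> G j \<omega>)" for n \<omega>
  proof -
    have "\<exists>i. i \<le> n \<and> (\<forall>j\<in>{..n}. G i \<omega> \<le> G j \<omega>)"
      using ex_is_arg_min_if_finite[of "{..n}" "\<lambda>i. G i \<omega>"] by (force simp: is_arg_min_linorder)
    then show ?thesis unfolding I_def by (rule LeastI_ex)
  qed
  have [measurable]: "I n \<in> measurable M (count_space UNIV)" for n
    unfolding I_def[abs_def] by measurable
  have "finite (I n ` space M)" for n
    by (rule finite_subset[of _ "{..n}"]) (use I in auto)
  then have "simple_function M (I n)" for n
    by (simp add: simple_function_eq_measurable)
  then have "simple_function M (\<lambda>\<omega>. d (I n \<omega>))" for n
    by (rule simple_function_compose1[where g=d])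
  then show ?thesis
  proof (rule measurable_sectionI[OF f])
    have "AE \<omega> in M. \<forall>i. compl_dist (sn \<omega>) (compl_emb (sn \<omega>) (d i)) (f \<omega>) = G i \<omega>"
      using eq by (simp add: AE_all_countable)
    with D(2) f AE_seminorm
    show "AE \<omega> in M. (\<lambda>n. compl_dist (sn \<omega>) (compl_emb (sn \<omega>) (d (I n \<omega>))) (f \<omega>)) \<longlonglongrightarrow> 0"
    proof eventually_elim
      case (elim \<omega>)
      have nonneg: "0 \<le> G i \<omega>" for i
        using compl_dist_nonneg[OF elim(3) compl_emb_in_compl_space[OF elim(3)] elim(2), of "d i"] elim(4) by simp
      have "(\<lambda>n. G (I n \<omega>) \<omega>) \<longlonglongrightarrow> 0"
      proof (rule LIMSEQ_I)
        fix e :: real assume "0 < e"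
        with elim(1) obtain v where "v \<in> D" "compl_dist (sn \<omega>) (compl_emb (sn \<omega>) v) (f \<omega>) < e" by blast
        with range_d elim(4) obtain i where i: "G i \<omega> < e" by (metis insertI2 rangeE)
        have "G (I n \<omega>) \<omega> < e" if "i \<le> n" for n
          using I[of n \<omega>] that i by (metis atMost_iff le_less_trans)
        with nonneg show "\<exists>N. \<forall>n\<ge>N. norm (G (I n \<omega>) \<omega> - 0) < e" by auto
      qed
      with elim(4) show ?case by simp
    qed
  qed
qed

text \<open>Glues finitely many measurable sections along a simple function: the union of their
  countable sets serves the glued section, and its distances are measurable by finite
  gluing.\<close>

lemma measurable_section_simple_function:
  assumes h: "simple_function M h" and G: "\<And>v. measurable_section M sn (G v)"
  shows "measurable_section M sn (\<lambda>\<omega>. G (h \<omega>) \<omega>)"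
proof -
  have fin: "finite (h ` space M)" using h by (simp add: simple_function_def)
  have "\<exists>D. \<forall>v. countable (D v) \<and>
      (AE \<omega> in M. \<forall>e>0. \<exists>d\<in>D v. compl_dist (sn \<omega>) (compl_emb (sn \<omega>) d) (G v \<omega>) < e)"
    by (intro choice allI measurable_section_separable G)
  then obtain D where D: "\<And>v. countable (D v)"
    "\<And>v. AE \<omega> in M. \<forall>e>0. \<exists>d\<in>D v. compl_dist (sn \<omega>) (compl_emb (sn \<omega>) d) (G v \<omega>) < e"
    by blast
  show ?thesis
  proof (rule measurable_section_separableI)
    have "AE \<omega> in M. \<forall>v\<in>h ` space M. G v \<omega> \<in> compl_space (sn \<omega>)"
      by (rule AE_finite_allI[OF fin]) (rule measurable_section_fibre[OF G])
    then show "AE \<omega> in M. G (h \<omega>) \<omega> \<in> compl_space (sn \<omega>)"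
      using AE_space by eventually_elim auto
    show "countable (\<Union>v\<in>h ` space M. D v)"
      by (intro countable_UN countable_finite fin D(1))
    have "AE \<omega> in M. \<forall>v\<in>h ` space M. \<forall>e>0. \<exists>d\<in>D v. compl_dist (sn \<omega>) (compl_emb (sn \<omega>) d) (G v \<omega>) < e"
      by (intro AE_finite_allI fin D(2))
    then show "AE \<omega> in M. \<forall>e>0. \<exists>d\<in>\<Union>v\<in>h ` space M. D v.
        compl_dist (sn \<omega>) (compl_emb (sn \<omega>) d) (G (h \<omega>) \<omega>) < e"
      using AE_space
    proof eventually_elim
      case (elim \<omega>)
      then have "\<forall>e>0. \<exists>d\<in>D (h \<omega>). compl_dist (sn \<omega>) (compl_emb (sn \<omega>) d) (G (h \<omega>) \<omega>) < e"
        by simp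
      with elim(2) show ?case by (meson UN_I imageI)
    qed
    show "ae_measurable M (\<lambda>\<omega>. compl_dist (sn \<omega>) (compl_emb (sn \<omega>) v) (G (h \<omega>) \<omega>))" for v
      by (rule ae_measurable_simple_function[OF h]) (rule measurable_section_dist[OF G])
  qed
qed

text \<open>Both conditions of the characterization survive limits: the union of the countable sets
  approximates \<open>f\<close> within two halves of \<open>e\<close>, and the distances to a fixed
  vector converge. This takes the place of a diagonal choice of simple sections.\<close>

lemma measurable_section_limit:
  assumes F: "\<And>k::nat. measurable_section M sn (F k)"
    and f: "AE \<omega> in M. f \<omega> \<in> compl_space (sn \<omega>)"
    and lim: "AE \<omega> in M. (\<lambda>k. compl_dist (sn \<omega>) (F k \<omega>) (f \<omega>)) \<longlonglongrightarrow> 0"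
  shows "measurable_section M sn f"
proof -
  have F_fibre: "AE \<omega> in M. \<forall>k. F k \<omega> \<in> compl_space (sn \<omega>)"
    using measurable_section_fibre[OF F] by (simp add: AE_all_countable)
  have "\<exists>D. \<forall>k. countable (D k) \<and>
      (AE \<omega> in M. \<forall>e>0. \<exists>d\<in>D k. compl_dist (sn \<omega>) (compl_emb (sn \<omega>) d) (F k \<omega>) < e)"
    by (intro choice allI measurable_section_separable F)
  then obtain D where D: "\<And>k. countable (D k)"
    "\<And>k. AE \<omega> in M. \<forall>e>0. \<exists>d\<in>D k. compl_dist (sn \<omega>) (compl_emb (sn \<omega>) d) (F k \<omega>) < e"
    by blast
  have Dk: "AE \<omega> in M. \<forall>k. \<forall>e>0. \<exists>d\<in>D k. compl_dist (sn \<omega>) (compl_emb (sn \<omega>) d) (F k \<omega>) < e"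
    using D(2) by (simp add: AE_all_countable)
  show ?thesis
  proof (rule measurable_section_separableI[OF f])
    show "countable (\<Union>k. D k)" using D(1) by auto
    show "AE \<omega> in M. \<forall>e>0. \<exists>d\<in>\<Union>k. D k. compl_dist (sn \<omega>) (compl_emb (sn \<omega>) d) (f \<omega>) < e"
      using Dk f F_fibre lim AE_seminorm
    proof eventually_elim
      case (elim \<omega>)
      show ?case
      proof (intro allI impI)
        fix e :: real assume e: "0 < e"
        from order_tendstoD(2)[OF elim(4), of "e / 2"] e obtain k
          where k: "compl_dist (sn \<omega>) (F k \<omega>) (f \<omega>) < e / 2"
          by (auto simp: eventually_sequentially)
        obtain d where d: "d \<in> D k" "compl_dist (sn \<omega>) (compl_emb (sn \<omega>) d) (F k \<omega>) < e / 2"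
          using elim(1) e half_gt_zero by blast
        have "compl_dist (sn \<omega>) (compl_emb (sn \<omega>) d) (f \<omega>) < e"
          using compl_dist_triangle[OF elim(5) compl_emb_in_compl_space[OF elim(5)] elim(3)[rule_format, of k] elim(2), of d] k d(2)
          by simp
        with d(1) show "\<exists>d\<in>\<Union>k. D k. compl_dist (sn \<omega>) (compl_emb (sn \<omega>) d) (f \<omega>) < e" by blast
      qed
    qed
    show "ae_measurable M (\<lambda>\<omega>. compl_dist (sn \<omega>) (compl_emb (sn \<omega>) v) (f \<omega>))" for v
    proof (rule ae_measurable_limit[OF measurable_section_dist[OF F]])
      show "AE \<omega> in M. (\<lambda>k. compl_dist (sn \<omega>) (compl_emb (sn \<omega>) v) (F k \<omega>))
          \<longlonglongrightarrow> compl_dist (sn \<omega>) (compl_emb (sn \<omega>) v) (f \<omega>)"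
        using f F_fibre lim AE_seminorm
        by eventually_elim (auto intro!: compl_dist_tendsto compl_emb_in_compl_space)
    qed
  qed
qed

end


section \<open>Measurable operator families\<close>

text \<open>The real-valued quotient whose image under \<open>ennreal\<close> enters the lattice
  supremum in \<open>random_norm\<close>; real values allow its use in estimates of real
  norms.\<close>

definition op_quotient ::
    "('w \<Rightarrow> 'v::real_vector \<Rightarrow> real) \<Rightarrow> ('w \<Rightarrow> (nat \<Rightarrow> 'v) set \<Rightarrow> (nat \<Rightarrow> 'v) set) \<Rightarrow> 'v \<Rightarrow> 'w \<Rightarrow> real" where
  "op_quotient sn P v \<omega> = compl_norm (sn \<omega>) (P \<omega> (compl_emb (sn \<omega>) v)) / sn \<omega> v"

text \<open>If \<open>A\<close> has infinite measure, the semifiniteness conjunct of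
  \<open>localizable\<close> supplies \<open>B\<close>; otherwise \<open>A\<close> itself
  serves.\<close>

lemma localizable_finite_subset:
  assumes "localizable M" "A \<in> sets M" "emeasure M A \<noteq> 0"
  obtains B where "B \<in> sets M" "B \<subseteq> A" "0 < emeasure M B" "emeasure M B < \<infinity>"
proof (cases "emeasure M A = \<infinity>")
  case True
  with assms(1,2) that show ?thesis unfolding localizable_def by blast
next
  case False
  with assms that[of A] show ?thesis by (simp add: zero_less_iff_neq_zero less_top)
qed

context
  fixes M :: "'w measure" and sn :: "'w \<Rightarrow> 'v::real_vector \<Rightarrow> real"
    and P :: "'w \<Rightarrow> (nat \<Rightarrow> 'v) set \<Rightarrow> (nat \<Rightarrow> 'v) set"
  assumes fam: "measurable_family M sn" and op: "measurable_operator_family M sn P"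
begin

lemma AE_bounded_operator: "AE \<omega> in M. bounded_operator (sn \<omega>) (P \<omega>)"
  using op by (simp add: measurable_operator_family_def)

lemma measurable_section_op_emb: "measurable_section M sn (\<lambda>\<omega>. P \<omega> (compl_emb (sn \<omega>) v))"
  using op by (simp add: measurable_operator_family_def)

text \<open>Along a simple section the image is glued from the sections
  \<open>P \<omega> (compl_emb (sn \<omega>) v)\<close>, which are measurable by assumption.
  Continuity of almost every \<open>P \<omega>\<close> then makes \<open>Pf\<close> an almost
  everywhere limit of such sections.\<close>

lemma measurable_section_pointwise_op:
  assumes f: "measurable_section M sn f"
  shows "measurable_section M sn (pointwise_op P f)"
proof -
  obtain h where h: "\<And>k::nat. simple_function M (h k)"
    and lim: "AE \<omega> in M. (\<lambda>k. compl_dist (sn \<omega>) (compl_emb (sn \<omega>) (h k \<omega>)) (f \<omega>)) \<longlonglongrightarrow> 0"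
    using measurable_sectionE[OF fam f] by blast
  have F: "measurable_section M sn (\<lambda>\<omega>. P \<omega> (compl_emb (sn \<omega>) (h k \<omega>)))" for k
    using measurable_section_simple_function[OF fam h, where G="\<lambda>v \<omega>. P \<omega> (compl_emb (sn \<omega>) v)",
        OF measurable_section_op_emb] .
  note fibre = measurable_section_fibre[OF fam f]
  show ?thesis
  proof (rule measurable_section_limit[OF fam F])
    show "AE \<omega> in M. pointwise_op P f \<omega> \<in> compl_space (sn \<omega>)"
      using fibre AE_seminorm[OF fam] AE_bounded_operator
      by eventually_elim (simp add: pointwise_op_def bounded_operator_closed)
    show "AE \<omega> in M. (\<lambda>k. compl_dist (sn \<omega>) (P \<omega> (compl_emb (sn \<omega>) (h k \<omega>))) (pointwise_op P f \<omega>)) \<longlonglongrightarrow> 0"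
      using fibre AE_seminorm[OF fam] AE_bounded_operator lim
    proof eventually_elim
      case (elim \<omega>)
      show ?case
        unfolding pointwise_op_def
        by (rule bounded_operator_tendsto[OF elim(2,3) compl_emb_in_compl_space[OF elim(2)] elim(1,4)])
    qed
  qed
qed

text \<open>The null set in the bound depends on \<open>v\<close>, but a sequence of simple sections
  approximating \<open>f\<close> takes only countably many values. Off one null set the bound holds
  for all of these, and it passes to the limit.\<close>

lemma pointwise_op_norm_le:
  assumes f: "measurable_section M sn f"
    and C: "\<And>v. AE \<omega> in M. compl_norm (sn \<omega>) (P \<omega> (compl_emb (sn \<omega>) v)) \<le> C * sn \<omega> v"
  shows "AE \<omega> in M. compl_norm (sn \<omega>) (pointwise_op P f \<omega>) \<le> C * compl_norm (sn \<omega>) (f \<omega>)"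
proof -
  obtain h where h: "\<And>k::nat. simple_function M (h k)"
    and lim: "AE \<omega> in M. (\<lambda>k. compl_dist (sn \<omega>) (compl_emb (sn \<omega>) (h k \<omega>)) (f \<omega>)) \<longlonglongrightarrow> 0"
    using measurable_sectionE[OF fam f] by blast
  have "AE \<omega> in M. \<forall>v\<in>h k ` space M. compl_norm (sn \<omega>) (P \<omega> (compl_emb (sn \<omega>) v)) \<le> C * sn \<omega> v" for k
    using h[of k] by (intro AE_finite_allI C) (simp add: simple_function_def)
  then have "AE \<omega> in M. \<forall>k. \<forall>v\<in>h k ` space M. compl_norm (sn \<omega>) (P \<omega> (compl_emb (sn \<omega>) v)) \<le> C * sn \<omega> v"
    by (simp only: AE_all_countable) blast
  with measurable_section_fibre[OF fam f] AE_seminorm[OF fam] AE_bounded_operator lim AE_space show ?thesis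
  proof eventually_elim
    case (elim \<omega>)
    note emb = compl_emb_in_compl_space[OF elim(2)]
    have le: "compl_norm (sn \<omega>) (P \<omega> (compl_emb (sn \<omega>) (h k \<omega>))) \<le> C * compl_norm (sn \<omega>) (compl_emb (sn \<omega>) (h k \<omega>))" for k
      using elim(5,6) by (simp add: compl_norm_emb[OF elim(2)])
    have "(\<lambda>k. compl_norm (sn \<omega>) (P \<omega> (compl_emb (sn \<omega>) (h k \<omega>)))) \<longlonglongrightarrow> compl_norm (sn \<omega>) (P \<omega> (f \<omega>))"
      by (rule compl_norm_tendsto[OF elim(2) _ _ bounded_operator_tendsto[OF elim(2,3) emb elim(1,4)]])
        (auto intro: bounded_operator_closed[OF elim(2,3)] emb elim(1))
    moreover have "(\<lambda>k. C * compl_norm (sn \<omega>) (compl_emb (sn \<omega>) (h k \<omega>))) \<longlonglongrightarrow> C * compl_norm (sn \<omega>) (f \<omega>)"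
      by (rule tendsto_mult_left[OF compl_norm_tendsto[OF elim(2) emb elim(1,4)]])
    ultimately show ?case
      unfolding pointwise_op_def by (rule LIMSEQ_le) (use le in blast)
  qed
qed

section \<open>The random norm and its almost everywhere bounds\<close>

lemma op_quotient_ae_measurable: "ae_measurable M (op_quotient sn P v)"
proof -
  obtain g where g: "g \<in> borel_measurable M"
    "AE \<omega> in M. compl_norm (sn \<omega>) (P \<omega> (compl_emb (sn \<omega>) v)) = g \<omega>"
    using measurable_section_norm[OF fam measurable_section_op_emb[of v]] unfolding ae_measurable_def by blast
  have "AE \<omega> in M. op_quotient sn P v \<omega> = g \<omega> / sn \<omega> v"
    using g(2) by eventually_elim (simp add: op_quotient_def)
  moreover have "(\<lambda>\<omega>. g \<omega> / sn \<omega> v) \<in> borel_measurable M"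
    using g(1) measurable_seminorm[OF fam] by (rule borel_measurable_divide)
  ultimately show ?thesis unfolding ae_measurable_def by (rule bexI)
qed

text \<open>The quotients themselves need not be measurable, so localizability is applied to
  measurable versions of them.\<close>

lemma is_lattice_sup_random_norm:
  assumes "localizable M"
  shows "is_lattice_sup M (range (\<lambda>v \<omega>. ennreal (op_quotient sn P v \<omega>))) (random_norm M sn P)"
proof -
  obtain g where g: "\<And>v. g v \<in> borel_measurable M" "\<And>v. AE \<omega> in M. op_quotient sn P v \<omega> = g v \<omega>"
    using ae_measurable_choice[where F="op_quotient sn P", OF op_quotient_ae_measurable] by blast
  have "range (\<lambda>v \<omega>. ennreal (g v \<omega>)) \<subseteq> borel_measurable M"
    using g(1) by auto
  then obtain s where s: "is_lattice_sup M (range (\<lambda>v \<omega>. ennreal (g v \<omega>))) s"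
    using assms unfolding localizable_def by blast
  \<comment> \<open>The two families have the same upper bounds up to null sets, hence the same
    lattice suprema.\<close>
  have iff: "(AE \<omega> in M. ennreal (g v \<omega>) \<le> r \<omega>) \<longleftrightarrow> (AE \<omega> in M. ennreal (op_quotient sn P v \<omega>) \<le> r \<omega>)" for v r
  proof
    assume "AE \<omega> in M. ennreal (g v \<omega>) \<le> r \<omega>"
    with g(2)[of v] show "AE \<omega> in M. ennreal (op_quotient sn P v \<omega>) \<le> r \<omega>" by eventually_elim simp
  next
    assume "AE \<omega> in M. ennreal (op_quotient sn P v \<omega>) \<le> r \<omega>"
    with g(2)[of v] show "AE \<omega> in M. ennreal (g v \<omega>) \<le> r \<omega>" by eventually_elim simp
  qed
  have "is_lattice_sup M (range (\<lambda>v \<omega>. ennreal (op_quotient sn P v \<omega>))) s"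
    using s unfolding is_lattice_sup_def by (simp add: iff)
  then show ?thesis
    unfolding random_norm_def lattice_Sup_def op_quotient_def by (rule someI[of "is_lattice_sup M _"])
qed

lemma random_norm_measurable: "localizable M \<Longrightarrow> random_norm M sn P \<in> borel_measurable M"
  using is_lattice_sup_random_norm by (simp add: is_lattice_sup_def)

text \<open>This is the defining property of the lattice supremum, tested on a constant function. It
  exchanges a bound on the random norm for one bound per vector, each with its own null set.\<close>

lemma random_norm_le_iff:
  assumes M: "localizable M" and C: "0 \<le> C"
  shows "(AE \<omega> in M. random_norm M sn P \<omega> \<le> ennreal C) \<longleftrightarrow> (\<forall>v. AE \<omega> in M. op_quotient sn P v \<omega> \<le> C)"
proof
  assume le: "AE \<omega> in M. random_norm M sn P \<omega> \<le> ennreal C"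
  show "\<forall>v. AE \<omega> in M. op_quotient sn P v \<omega> \<le> C"
  proof
    fix v
    have "AE \<omega> in M. ennreal (op_quotient sn P v \<omega>) \<le> random_norm M sn P \<omega>"
      using is_lattice_sup_random_norm[OF M] by (auto simp: is_lattice_sup_def)
    with le show "AE \<omega> in M. op_quotient sn P v \<omega> \<le> C"
      by eventually_elim (metis C ennreal_le_iff order_trans)
  qed
next
  assume "\<forall>v. AE \<omega> in M. op_quotient sn P v \<omega> \<le> C"
  then have "AE \<omega> in M. ennreal (op_quotient sn P v \<omega>) \<le> ennreal C" for v
    by (auto elim!: eventually_mono intro: ennreal_leI)
  then have "\<forall>f\<in>range (\<lambda>v \<omega>. ennreal (op_quotient sn P v \<omega>)). AE \<omega> in M. f \<omega> \<le> ennreal C"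
    by blast
  with is_lattice_sup_random_norm[OF M] show "AE \<omega> in M. random_norm M sn P \<omega> \<le> ennreal C"
    unfolding is_lattice_sup_def by (elim conjE) (drule bspec[where x="\<lambda>_. ennreal C"], simp_all)
qed

text \<open>Clearing the denominator is possible where the seminorm is positive; where it vanishes,
  boundedness of \<open>P \<omega>\<close> makes the left side 0.\<close>

lemma op_emb_norm_le:
  assumes "AE \<omega> in M. op_quotient sn P v \<omega> \<le> C"
  shows "AE \<omega> in M. compl_norm (sn \<omega>) (P \<omega> (compl_emb (sn \<omega>) v)) \<le> C * sn \<omega> v"
  using assms AE_seminorm[OF fam] AE_bounded_operator
proof eventually_elim
  case (elim \<omega>)
  show ?case
  proof (cases "sn \<omega> v = 0")
    case True
    then show ?thesis using bounded_operator_norm_emb_zero[OF elim(2,3)] by simp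
  next
    case False
    then have "0 < sn \<omega> v" using seminorm_nonneg[OF elim(2), of v] by simp
    with elim(1) show ?thesis by (simp add: op_quotient_def pos_divide_le_eq)
  qed
qed

text \<open>Leastness of the lattice supremum produces one vector whose quotient exceeds
  \<open>c\<close> on a non-null set, and semifiniteness cuts this set down to positive finite
  measure. The result supplies the test vectors for both lower estimates.\<close>

lemma random_norm_exceeds:
  assumes M: "localizable M" and c: "0 \<le> c" and ex: "\<not> (AE \<omega> in M. random_norm M sn P \<omega> \<le> ennreal c)"
  shows "\<exists>v A. A \<in> sets M \<and> 0 < emeasure M A \<and> emeasure M A < \<infinity> \<and>
    (AE \<omega> in M. \<omega> \<in> A \<longrightarrow> c < op_quotient sn P v \<omega>)"
proof -
  obtain v where v: "\<not> (AE \<omega> in M. op_quotient sn P v \<omega> \<le> c)"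
    using ex random_norm_le_iff[OF M c] by blast
  obtain g where g[measurable]: "g \<in> borel_measurable M" and eq: "AE \<omega> in M. op_quotient sn P v \<omega> = g \<omega>"
    using op_quotient_ae_measurable[of v] unfolding ae_measurable_def by blast
  let ?A = "{\<omega>\<in>space M. c < g \<omega>}"
  have "emeasure M ?A \<noteq> 0"
  proof
    assume "emeasure M ?A = 0"
    then have "AE \<omega> in M. \<not> c < g \<omega>"
      by (subst AE_iff_measurable[of ?A]) auto
    with eq have "AE \<omega> in M. op_quotient sn P v \<omega> \<le> c" by eventually_elim simp
    with v show False by blast
  qed
  then obtain A where A: "A \<in> sets M" "A \<subseteq> ?A" "0 < emeasure M A" "emeasure M A < \<infinity>"
    using localizable_finite_subset[OF M, of ?A] by auto
  have "AE \<omega> in M. \<omega> \<in> A \<longrightarrow> c < op_quotient sn P v \<omega>"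
    using eq by eventually_elim (use A(2) in auto)
  with A show ?thesis by blast
qed

text \<open>Test sections with prescribed norm: the vector chosen by \<open>n\<close> is normalized
  fibrewise and multiplied by \<open>u\<close>, so that \<open>P\<close> acts on the norm as
  multiplication by the quotient. A variable index \<open>n\<close> allows countably many vectors in
  one section.\<close>

lemma normalized_section:
  fixes v :: "nat \<Rightarrow> 'v"
  assumes u[measurable]: "u \<in> borel_measurable M" and n[measurable]: "n \<in> measurable M (count_space UNIV)"
    and supp: "AE \<omega> in M. u \<omega> \<noteq> 0 \<longrightarrow> sn \<omega> (v (n \<omega>)) \<noteq> 0"
  defines "f \<equiv> \<lambda>\<omega>. compl_emb (sn \<omega>) ((u \<omega> / sn \<omega> (v (n \<omega>))) *\<^sub>R v (n \<omega>))"
  shows "measurable_section M sn f"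
    and "AE \<omega> in M. compl_norm (sn \<omega>) (f \<omega>) = \<bar>u \<omega>\<bar>"
    and "AE \<omega> in M. compl_norm (sn \<omega>) (pointwise_op P f \<omega>) = \<bar>u \<omega>\<bar> * op_quotient sn P (v (n \<omega>)) \<omega>"
proof -
  define q where "q \<omega> = u \<omega> / sn \<omega> (v (n \<omega>))" for \<omega>
  have "(\<lambda>\<omega>. sn \<omega> (v (n \<omega>))) \<in> borel_measurable M"
    using measurable_compose_countable[where f="\<lambda>i \<omega>. sn \<omega> (v i)" and g=n, OF measurable_seminorm[OF fam] n] .
  then have [measurable]: "q \<in> borel_measurable M" unfolding q_def[abs_def] by measurable
  obtain s where s: "\<And>k. simple_function M (s k)" "\<And>\<omega>. \<omega> \<in> space M \<Longrightarrow> (\<lambda>k. s k \<omega>) \<longlonglongrightarrow> q \<omega>"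
    using borel_measurable_implies_sequence_metric[of q M 0] by auto
  \<comment> \<open>Truncating the index at \<open>k\<close> leaves finitely many vectors. At a
    fixed point the truncation is inactive once \<open>k\<close> reaches \<open>n \<omega>\<close>,
    and then only the coefficient error \<open>s k \<omega> - q \<omega>\<close> remains.\<close>
  have "simple_function M (\<lambda>\<omega>. min (n \<omega>) k)" for k
    unfolding simple_function_eq_measurable
    by (auto intro: finite_subset[of _ "{..k}"])
  then have h: "simple_function M (\<lambda>\<omega>. s k \<omega> *\<^sub>R v (min (n \<omega>) k))" for k
    using simple_function_compose2[where h="\<lambda>a i. a *\<^sub>R v i", OF s(1)] by blast
  show "measurable_section M sn f"
  proof (rule measurable_sectionI[OF fam _ h])
    show "AE \<omega> in M. f \<omega> \<in> compl_space (sn \<omega>)"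
      using AE_seminorm[OF fam] unfolding f_def by eventually_elim (rule compl_emb_in_compl_space)
    show "AE \<omega> in M. (\<lambda>k. compl_dist (sn \<omega>) (compl_emb (sn \<omega>) (s k \<omega> *\<^sub>R v (min (n \<omega>) k))) (f \<omega>)) \<longlonglongrightarrow> 0"
      using AE_seminorm[OF fam] AE_space
    proof eventually_elim
      case (elim \<omega>)
      have "(\<lambda>k. \<bar>s k \<omega> - q \<omega>\<bar> * sn \<omega> (v (n \<omega>))) \<longlonglongrightarrow> 0"
        using s(2)[OF elim(2)] by (intro tendsto_mult_left_zero tendsto_rabs_zero) (simp add: LIM_zero)
      moreover have "\<forall>\<^sub>F k in sequentially. \<bar>s k \<omega> - q \<omega>\<bar> * sn \<omega> (v (n \<omega>)) =
          compl_dist (sn \<omega>) (compl_emb (sn \<omega>) (s k \<omega> *\<^sub>R v (min (n \<omega>) k))) (f \<omega>)"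
        using eventually_ge_at_top[of "n \<omega>"]
      proof eventually_elim
        case (elim k)
        then show ?case
          by (simp add: f_def q_def[symmetric] compl_dist_emb[OF \<open>seminorm (sn \<omega>)\<close>] min_absorb1
              scaleR_diff_left[symmetric] seminorm_scale[OF \<open>seminorm (sn \<omega>)\<close>])
      qed
      ultimately show ?case by (rule Lim_transform_eventually)
    qed
  qed
  show "AE \<omega> in M. compl_norm (sn \<omega>) (f \<omega>) = \<bar>u \<omega>\<bar>"
    using AE_seminorm[OF fam] supp
  proof eventually_elim
    case (elim \<omega>)
    then show ?case
      using seminorm_nonneg[OF elim(1), of "v (n \<omega>)"]
      by (cases "u \<omega> = 0") (simp_all add: f_def compl_norm_emb seminorm_scale seminorm_zero)
  qed
  \<comment> \<open>At points where the seminorm of the chosen vector is 0, both sides are 0 through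
    division by zero.\<close>
  show "AE \<omega> in M. compl_norm (sn \<omega>) (pointwise_op P f \<omega>) = \<bar>u \<omega>\<bar> * op_quotient sn P (v (n \<omega>)) \<omega>"
    using AE_seminorm[OF fam] AE_bounded_operator
  proof eventually_elim
    case (elim \<omega>)
    show ?case
      unfolding f_def pointwise_op_def compl_emb_scale[OF elim(1)]
        bounded_operator_scale_norm[OF elim compl_emb_in_compl_space[OF elim(1)]] op_quotient_def
      using seminorm_nonneg[OF elim(1), of "v (n \<omega>)"] by simp
  qed
qed

end


section \<open>Koethe function spaces\<close>

context
  fixes M :: "'w measure" and K :: "('w \<Rightarrow> real) set" and nK :: "('w \<Rightarrow> real) \<Rightarrow> real"
  assumes K: "koethe_space M K nK"
begin

lemma koethe_measurable: "f \<in> K \<Longrightarrow> f \<in> borel_measurable M"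
  using K[unfolded koethe_space_def, THEN conjunct1] by blast

lemma koethe_zero: "(\<lambda>_. 0) \<in> K"
  by (rule K[unfolded koethe_space_def, THEN conjunct2, THEN conjunct1])

lemma koethe_add: "\<lbrakk>f \<in> K; g \<in> K\<rbrakk> \<Longrightarrow> (\<lambda>\<omega>. f \<omega> + g \<omega>) \<in> K"
  and koethe_triangle: "\<lbrakk>f \<in> K; g \<in> K\<rbrakk> \<Longrightarrow> nK (\<lambda>\<omega>. f \<omega> + g \<omega>) \<le> nK f + nK g"
  using K[unfolded koethe_space_def, THEN conjunct2, THEN conjunct2, THEN conjunct1] by simp_all

lemma koethe_scale: "f \<in> K \<Longrightarrow> (\<lambda>\<omega>. c * f \<omega>) \<in> K"
  and koethe_norm_scale: "f \<in> K \<Longrightarrow> nK (\<lambda>\<omega>. c * f \<omega>) = \<bar>c\<bar> * nK f"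
  using K[unfolded koethe_space_def, THEN conjunct2, THEN conjunct2, THEN conjunct2, THEN conjunct1] by simp_all

lemma koethe_norm_eq_0: "f \<in> K \<Longrightarrow> nK f = 0 \<longleftrightarrow> (AE \<omega> in M. f \<omega> = 0)"
  using K[unfolded koethe_space_def, THEN conjunct2, THEN conjunct2, THEN conjunct2, THEN conjunct2, THEN conjunct1] by (rule bspec)

lemma koethe_complete:
  assumes "\<And>n::nat. F n \<in> K" and "\<And>e. 0 < e \<Longrightarrow> \<exists>N. \<forall>m\<ge>N. \<forall>n\<ge>N. nK (\<lambda>\<omega>. F m \<omega> - F n \<omega>) < e"
  shows "\<exists>g\<in>K. (\<lambda>n. nK (\<lambda>\<omega>. F n \<omega> - g \<omega>)) \<longlonglongrightarrow> 0"
  using K[unfolded koethe_space_def, THEN conjunct2, THEN conjunct2, THEN conjunct2, THEN conjunct2, THEN conjunct2, THEN conjunct1] assms by simp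

lemma koethe_indicator: "\<lbrakk>A \<in> sets M; emeasure M A < \<infinity>\<rbrakk> \<Longrightarrow> indicator A \<in> K"
  using K[unfolded koethe_space_def, THEN conjunct2, THEN conjunct2, THEN conjunct2, THEN conjunct2, THEN conjunct2, THEN conjunct2, THEN conjunct1] by blast

lemma koethe_solid: "\<lbrakk>f \<in> K; g \<in> borel_measurable M; AE \<omega> in M. \<bar>g \<omega>\<bar> \<le> \<bar>f \<omega>\<bar>\<rbrakk> \<Longrightarrow> g \<in> K"
  and koethe_mono: "\<lbrakk>f \<in> K; g \<in> borel_measurable M; AE \<omega> in M. \<bar>g \<omega>\<bar> \<le> \<bar>f \<omega>\<bar>\<rbrakk> \<Longrightarrow> nK g \<le> nK f"
  using K[unfolded koethe_space_def, THEN conjunct2, THEN conjunct2, THEN conjunct2, THEN conjunct2, THEN conjunct2, THEN conjunct2, THEN conjunct2, THEN conjunct2] by simp_all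

lemma koethe_diff: "\<lbrakk>f \<in> K; g \<in> K\<rbrakk> \<Longrightarrow> (\<lambda>\<omega>. f \<omega> - g \<omega>) \<in> K"
  using koethe_add[of f "\<lambda>\<omega>. - 1 * g \<omega>"] koethe_scale[of g "- 1"] by simp

lemma koethe_norm_minus_commute:
  assumes "f \<in> K" "g \<in> K"
  shows "nK (\<lambda>\<omega>. f \<omega> - g \<omega>) = nK (\<lambda>\<omega>. g \<omega> - f \<omega>)"
  using koethe_norm_scale[OF koethe_diff[OF assms], of "- 1"] by simp

text \<open>Follows from the triangle inequality for \<open>f\<close> and its negative, whose sum
  has norm 0.\<close>

lemma koethe_norm_nonneg:
  assumes f: "f \<in> K" shows "0 \<le> nK f"
proof -
  have "nK (\<lambda>\<omega>. f \<omega> + - 1 * f \<omega>) \<le> nK f + nK (\<lambda>\<omega>. - 1 * f \<omega>)"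
    by (rule koethe_triangle[OF f koethe_scale[OF f]])
  then show ?thesis
    using koethe_norm_scale[OF f, of "- 1"] koethe_norm_eq_0[OF koethe_zero] by simp
qed

lemma koethe_norm_cong:
  assumes "f \<in> K" "g \<in> K" "AE \<omega> in M. f \<omega> = g \<omega>"
  shows "nK f = nK g"
proof (rule antisym)
  show "nK f \<le> nK g" "nK g \<le> nK f"
    using assms(3) by (auto intro!: koethe_mono koethe_measurable assms(1,2))
qed

text \<open>By definiteness, norm 0 would make the indicator vanish almost everywhere and
  \<open>A\<close> a null set.\<close>

lemma koethe_indicator_norm_pos:
  assumes A: "A \<in> sets M" "emeasure M A < \<infinity>" "0 < emeasure M A"
  shows "0 < nK (indicator A)"
proof -
  have "nK (indicator A) \<noteq> 0"
  proof
    assume "nK (indicator A) = 0"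
    then have "AE \<omega> in M. indicator A \<omega> = (0::real)"
      using koethe_norm_eq_0[OF koethe_indicator[OF A(1,2)]] by simp
    then have "AE \<omega> in M. \<omega> \<notin> A" by eventually_elim (simp add: indicator_eq_0_iff)
    then have "emeasure M A = 0"
      using AE_iff_measurable[OF A(1), of "\<lambda>\<omega>. \<omega> \<notin> A"] sets.sets_into_space[OF A(1)] by auto
    with A(3) show False by simp
  qed
  with koethe_norm_nonneg[OF koethe_indicator[OF A(1,2)]] show ?thesis by simp
qed

text \<open>The geometric bounds make the partial sums Cauchy, so they have a limit \<open>g\<close>
  in \<open>K\<close>. The main point is to identify \<open>g\<close> with the pointwise sum: this
  is done by solidity on sets where the partial sums are eventually constant.\<close>

lemma koethe_disjoint_sum:
  fixes B :: "nat \<Rightarrow> 'w set" and t :: "nat \<Rightarrow> real"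
  assumes B: "\<And>m. B m \<in> sets M" "\<And>m. emeasure M (B m) < \<infinity>" and disj: "disjoint_family B"
    and t: "\<And>m. \<bar>t m\<bar> * nK (indicator (B m)) \<le> (1 / 2) ^ m"
  obtains u where "u \<in> K" "\<And>m \<omega>. \<omega> \<in> B m \<Longrightarrow> u \<omega> = t m" "\<And>\<omega>. (\<And>m. \<omega> \<notin> B m) \<Longrightarrow> u \<omega> = 0"
proof -
  define S where "S n \<omega> = (\<Sum>m<n. t m * indicator (B m) \<omega>)" for n \<omega>
  define u where "u \<omega> = (\<Sum>m. t m * indicator (B m) \<omega>)" for \<omega>
  have tB: "(\<lambda>\<omega>. t m * indicator (B m) \<omega>) \<in> K" for m
    by (intro koethe_scale koethe_indicator B)
  have S_Suc: "S (Suc n) = (\<lambda>\<omega>. S n \<omega> + t n * indicator (B n) \<omega>)" for n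
    unfolding S_def[abs_def] sum.lessThan_Suc ..
  have S_K: "S n \<in> K" for n
  proof (induction n)
    case 0
    then show ?case using koethe_zero by (simp add: S_def[abs_def])
  next
    case (Suc n)
    show ?case unfolding S_Suc by (rule koethe_add[OF Suc.IH tB])
  qed
  \<comment> \<open>The right side is the exact value of the geometric sum over the indices from
    \<open>n\<close> up to, but excluding, \<open>n + k\<close>.\<close>
  have S_diff: "nK (\<lambda>\<omega>. S (n + k) \<omega> - S n \<omega>) \<le> 2 * (1 / 2) ^ n - 2 * (1 / 2) ^ (n + k)" for n k
  proof (induction k)
    case 0
    show ?case using koethe_norm_eq_0[OF koethe_zero] by simp
  next
    case (Suc k)
    have "nK (\<lambda>\<omega>. (S (n + k) \<omega> - S n \<omega>) + t (n + k) * indicator (B (n + k)) \<omega>)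
        \<le> nK (\<lambda>\<omega>. S (n + k) \<omega> - S n \<omega>) + nK (\<lambda>\<omega>. t (n + k) * indicator (B (n + k)) \<omega>)"
      by (rule koethe_triangle[OF koethe_diff[OF S_K S_K] tB])
    also have "nK (\<lambda>\<omega>. t (n + k) * indicator (B (n + k)) \<omega>) \<le> (1 / 2) ^ (n + k)"
      using koethe_norm_scale[OF koethe_indicator[OF B], of "t (n + k)"] t[of "n + k"] by simp
    finally show ?case using Suc.IH by (simp add: S_Suc algebra_simps)
  qed
  have S_le: "nK (\<lambda>\<omega>. S m \<omega> - S n \<omega>) \<le> 2 * (1 / 2) ^ N" if "N \<le> n" "n \<le> m" for N n m
  proof -
    have "nK (\<lambda>\<omega>. S m \<omega> - S n \<omega>) \<le> 2 * (1 / 2) ^ n - 2 * (1 / 2) ^ m"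
      using S_diff[of n "m - n"] that by simp
    also have "\<dots> \<le> 2 * (1 / 2) ^ n" by simp
    also have "\<dots> \<le> 2 * (1 / 2) ^ N"
      using that by (simp add: power_decreasing)
    finally show ?thesis .
  qed
  have "\<exists>N. \<forall>m\<ge>N. \<forall>n\<ge>N. nK (\<lambda>\<omega>. S m \<omega> - S n \<omega>) < e" if e: "0 < e" for e
  proof -
    obtain N where N: "(1 / 2) ^ N < e / 2"
      using real_arch_pow_inv[of "e / 2" "1 / 2"] e by auto
    have "nK (\<lambda>\<omega>. S m \<omega> - S n \<omega>) < e" if "N \<le> m" "N \<le> n" for m n
    proof (cases "n \<le> m")
      case True
      then show ?thesis using S_le[of N n m] that N by simp
    next
      case False
      then show ?thesis
        using S_le[of N m n] that N by (subst koethe_norm_minus_commute[OF S_K S_K]) simp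
    qed
    then show ?thesis by blast
  qed
  from koethe_complete[OF S_K this] obtain g
    where g: "g \<in> K" and lim: "(\<lambda>n. nK (\<lambda>\<omega>. S n \<omega> - g \<omega>)) \<longlonglongrightarrow> 0" by blast
  have u_on: "u \<omega> = t m" if "\<omega> \<in> B m" for m \<omega>
  proof -
    have "t i * indicator (B i) \<omega> = 0" if "i \<noteq> m" for i
      using disj \<open>\<omega> \<in> B m\<close> that by (auto simp: disjoint_family_on_def indicator_def)
    then have "u \<omega> = (\<Sum>i\<in>{m}. t i * indicator (B i) \<omega>)"
      unfolding u_def by (intro suminf_finite) auto
    with that show ?thesis by simp
  qed
  have u_off: "u \<omega> = 0" if "\<And>m. \<omega> \<notin> B m" for \<omega>
    using that by (simp add: u_def)
  have S_eq: "S n \<omega> = u \<omega>" if "\<And>m. n \<le> m \<Longrightarrow> \<omega> \<notin> B m" for n \<omega>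
    unfolding S_def u_def using that by (intro suminf_finite[symmetric]) auto
  have [measurable]: "u \<in> borel_measurable M" "g \<in> borel_measurable M" "\<And>m. B m \<in> sets M"
    using B(1) koethe_measurable[OF g] unfolding u_def[abs_def] by measurable
  \<comment> \<open>On \<open>C j\<close> all partial sums from \<open>S j\<close> on equal
    \<open>u\<close>, so the restriction of \<open>u - g\<close> to \<open>C j\<close> is dominated
    by \<open>S n - g\<close> for every \<open>n \<ge> j\<close>. Its norm is therefore 0.\<close>
  define C where "C j = {\<omega>\<in>space M. \<forall>m\<ge>j. \<omega> \<notin> B m}" for j
  have C[measurable]: "C j \<in> sets M" for j unfolding C_def by measurable
  have "AE \<omega> in M. (u \<omega> - g \<omega>) * indicator (C j) \<omega> = 0" for j
  proof -
    let ?d = "\<lambda>\<omega>. (u \<omega> - g \<omega>) * indicator (C j) \<omega>"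
    have le: "\<bar>?d \<omega>\<bar> \<le> \<bar>S n \<omega> - g \<omega>\<bar>" if "j \<le> n" for n \<omega>
      using S_eq[of n \<omega>] that by (auto simp: C_def indicator_def)
    have meas: "?d \<in> borel_measurable M" by measurable
    have d_K: "?d \<in> K"
      by (rule koethe_solid[OF koethe_diff[OF S_K[of j] g] meas]) (use le in blast)
    have "nK ?d \<le> nK (\<lambda>\<omega>. S n \<omega> - g \<omega>)" if "j \<le> n" for n
      by (rule koethe_mono[OF koethe_diff[OF S_K[of n] g] meas]) (use le that in blast)
    then have "nK ?d \<le> 0" by (intro LIMSEQ_le_const[OF lim]) blast
    then show ?thesis
      using koethe_norm_nonneg[OF d_K] koethe_norm_eq_0[OF d_K] by simp
  qed
  then have "AE \<omega> in M. \<forall>j. (u \<omega> - g \<omega>) * indicator (C j) \<omega> = 0" by (simp only: AE_all_countable) blast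
  then have "AE \<omega> in M. u \<omega> = g \<omega>"
    using AE_space
  proof eventually_elim
    case (elim \<omega>)
    \<comment> \<open>By disjointness a point lies in at most one \<open>B m\<close>, and hence in
      \<open>C (Suc m)\<close> or in every \<open>C j\<close>.\<close>
    have "\<exists>j. \<omega> \<in> C j"
    proof (cases "\<exists>m. \<omega> \<in> B m")
      case True
      then obtain m where m: "\<omega> \<in> B m" by blast
      then have "\<omega> \<notin> B i" if "Suc m \<le> i" for i
        using disjoint_family_onD[OF disj, of m i] that by auto
      with elim(2) show ?thesis by (auto simp: C_def)
    qed (use elim(2) in \<open>auto simp: C_def\<close>)
    then obtain j where "\<omega> \<in> C j" by blast
    with elim(1)[rule_format, of j] show ?case by simp
  qed
  then have "AE \<omega> in M. \<bar>u \<omega>\<bar> \<le> \<bar>g \<omega>\<bar>" by eventually_elim simp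
  then have "u \<in> K" by (intro koethe_solid[OF g]) simp_all
  from that[OF this u_on u_off] show ?thesis by simp
qed

section \<open>Membership and norm in the \<open>K\<close>-direct integral\<close>

context
  fixes sn :: "'w \<Rightarrow> 'v::real_vector \<Rightarrow> real"
begin

lemma K_direct_integralI:
  "\<lbrakk>measurable_section M sn f; g \<in> K; AE \<omega> in M. compl_norm (sn \<omega>) (f \<omega>) = g \<omega>\<rbrakk>
    \<Longrightarrow> f \<in> K_direct_integral M sn K"
  unfolding K_direct_integral_def by blast

lemma K_direct_integralE:
  assumes "f \<in> K_direct_integral M sn K"
  obtains g where "measurable_section M sn f" "g \<in> K" "AE \<omega> in M. compl_norm (sn \<omega>) (f \<omega>) = g \<omega>"
  using assms unfolding K_direct_integral_def by blast

lemma K_norm_eq: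
  assumes g: "g \<in> K" "AE \<omega> in M. compl_norm (sn \<omega>) (f \<omega>) = g \<omega>"
  shows "K_norm M sn K nK f = nK g"
proof -
  let ?h = "SOME g. g \<in> K \<and> (AE \<omega> in M. compl_norm (sn \<omega>) (f \<omega>) = g \<omega>)"
  have h: "?h \<in> K \<and> (AE \<omega> in M. compl_norm (sn \<omega>) (f \<omega>) = ?h \<omega>)"
    by (rule someI[of "\<lambda>g. g \<in> K \<and> (AE \<omega> in M. compl_norm (sn \<omega>) (f \<omega>) = g \<omega>)" g]) (simp add: g)
  then have "AE \<omega> in M. compl_norm (sn \<omega>) (f \<omega>) = ?h \<omega>" by blast
  with g(2) have "AE \<omega> in M. ?h \<omega> = g \<omega>" by eventually_elim simp
  with h g(1) show ?thesis
    unfolding K_norm_def by (intro koethe_norm_cong) auto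
qed

lemma K_norm_nonneg:
  assumes "f \<in> K_direct_integral M sn K"
  shows "0 \<le> K_norm M sn K nK f"
proof -
  obtain g where "g \<in> K" "AE \<omega> in M. compl_norm (sn \<omega>) (f \<omega>) = g \<omega>"
    using K_direct_integralE[OF assms] by blast
  then show ?thesis by (simp add: K_norm_eq koethe_norm_nonneg)
qed

end

end


section \<open>Operators on the K-direct integral\<close>

context
  fixes M :: "'w measure" and sn :: "'w \<Rightarrow> 'v::real_vector \<Rightarrow> real"
    and K :: "('w \<Rightarrow> real) set" and nK :: "('w \<Rightarrow> real) \<Rightarrow> real"
    and P :: "'w \<Rightarrow> (nat \<Rightarrow> 'v) set \<Rightarrow> (nat \<Rightarrow> 'v) set"
  assumes M: "localizable M" and fam: "measurable_family M sn" and K: "koethe_space M K nK"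
    and op: "measurable_operator_family M sn P"
begin

text \<open>The bound passes from the random norm to vectors, then to sections. The norm of
  \<open>Pf\<close> is thus dominated by \<open>C\<close> times that of \<open>f\<close>; solidity
  of \<open>K\<close> gives membership and monotonicity of \<open>nK\<close> the estimate.\<close>

lemma K_direct_integral_op_bound:
  assumes C: "0 \<le> C" "AE \<omega> in M. random_norm M sn P \<omega> \<le> ennreal C" and f: "f \<in> K_direct_integral M sn K"
  shows "pointwise_op P f \<in> K_direct_integral M sn K"
    and "K_norm M sn K nK (pointwise_op P f) \<le> C * K_norm M sn K nK f"
proof -
  obtain g where f_sec: "measurable_section M sn f" and g: "g \<in> K" "AE \<omega> in M. compl_norm (sn \<omega>) (f \<omega>) = g \<omega>"
    using K_direct_integralE[OF K f] by blast
  note Pf_sec = measurable_section_pointwise_op[OF fam op f_sec]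
  obtain h where h: "h \<in> borel_measurable M" "AE \<omega> in M. compl_norm (sn \<omega>) (pointwise_op P f \<omega>) = h \<omega>"
    using measurable_section_norm[OF fam Pf_sec] unfolding ae_measurable_def by blast
  have "AE \<omega> in M. op_quotient sn P v \<omega> \<le> C" for v
    using C random_norm_le_iff[OF fam op M] by blast
  then have "AE \<omega> in M. compl_norm (sn \<omega>) (pointwise_op P f \<omega>) \<le> C * compl_norm (sn \<omega>) (f \<omega>)"
    by (intro pointwise_op_norm_le[OF fam op f_sec] op_emb_norm_le[OF fam op])
  with g(2) h(2) AE_seminorm[OF fam] measurable_section_fibre[OF fam Pf_sec]
  have le: "AE \<omega> in M. \<bar>h \<omega>\<bar> \<le> \<bar>C * g \<omega>\<bar>"
  proof eventually_elim
    case (elim \<omega>)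
    then show ?case using compl_norm_nonneg[OF elim(3,4)] by simp
  qed
  have h_K: "h \<in> K" by (rule koethe_solid[OF K koethe_scale[OF K g(1)] h(1) le])
  show "pointwise_op P f \<in> K_direct_integral M sn K"
    by (rule K_direct_integralI[OF K Pf_sec h_K h(2)])
  have "nK h \<le> C * nK g"
    using koethe_mono[OF K koethe_scale[OF K g(1)] h(1) le] koethe_norm_scale[OF K g(1), of C] C(1) by simp
  then show "K_norm M sn K nK (pointwise_op P f) \<le> C * K_norm M sn K nK f"
    by (simp add: K_norm_eq[OF K g] K_norm_eq[OF K h_K h(2)])
qed

lemma bounded_operator_K_pointwise_op:
  assumes C: "0 \<le> C" "AE \<omega> in M. random_norm M sn P \<omega> \<le> ennreal C"
  shows "bounded_operator_K M sn K nK (pointwise_op P)"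
  unfolding bounded_operator_K_def
proof (intro conjI ballI allI impI)
  fix f g assume "AE \<omega> in M. f \<omega> = (g \<omega> :: (nat \<Rightarrow> 'v) set)"
  then show "AE \<omega> in M. pointwise_op P f \<omega> = pointwise_op P g \<omega>"
    by eventually_elim (simp add: pointwise_op_def)
next
  fix f g assume "f \<in> K_direct_integral M sn K" "g \<in> K_direct_integral M sn K"
  then have "AE \<omega> in M. f \<omega> \<in> compl_space (sn \<omega>)" "AE \<omega> in M. g \<omega> \<in> compl_space (sn \<omega>)"
    by (auto simp: K_direct_integral_def measurable_section_def)
  with AE_bounded_operator[OF fam op]
  show "AE \<omega> in M. pointwise_op P (\<lambda>\<omega>. compl_add (sn \<omega>) (f \<omega>) (g \<omega>)) \<omega> =
      compl_add (sn \<omega>) (pointwise_op P f \<omega>) (pointwise_op P g \<omega>)"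
    by eventually_elim (simp add: pointwise_op_def bounded_operator_def)
next
  fix c :: real and f assume "f \<in> K_direct_integral M sn K"
  then have "AE \<omega> in M. f \<omega> \<in> compl_space (sn \<omega>)"
    by (auto simp: K_direct_integral_def measurable_section_def)
  with AE_bounded_operator[OF fam op]
  show "AE \<omega> in M. pointwise_op P (\<lambda>\<omega>. compl_scale (sn \<omega>) c (f \<omega>)) \<omega> =
      compl_scale (sn \<omega>) c (pointwise_op P f \<omega>)"
    by eventually_elim (simp add: pointwise_op_def bounded_operator_def)
qed (use K_direct_integral_op_bound[OF C] in blast)+

text \<open>Finiteness of the operator norm in each fibre, with \<open>C\<close> depending on the
  point but one null set for all \<open>v\<close>. It later shows that a point meets only finitely
  many humps.\<close>

lemma AE_op_quotient_bounded: "AE \<omega> in M. \<exists>C. \<forall>v. op_quotient sn P v \<omega> \<le> C"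
  using AE_seminorm[OF fam] AE_bounded_operator[OF fam op]
proof eventually_elim
  case (elim \<omega>)
  obtain C where C: "\<And>X. X \<in> compl_space (sn \<omega>) \<Longrightarrow> compl_norm (sn \<omega>) (P \<omega> X) \<le> C * compl_norm (sn \<omega>) X"
    using bounded_operator_bound[OF elim] by blast
  have "op_quotient sn P v \<omega> \<le> max C 0" for v
  proof (cases "sn \<omega> v = 0")
    case False
    then have "0 < sn \<omega> v" using seminorm_nonneg[OF elim(1), of v] by simp
    with C[OF compl_emb_in_compl_space[OF elim(1)], of v] have "op_quotient sn P v \<omega> \<le> C"
      by (simp add: op_quotient_def compl_norm_emb[OF elim(1)] pos_divide_le_eq)
    then show ?thesis by simp
  qed (simp add: op_quotient_def)
  then show ?case by blast
qed

text \<open>A gliding hump.  If the random norm is unbounded, each \<open>m\<close> has a vector \<open>v\<^sub>m\<close> whose norm is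
  expanded by more than \<open>4\<^sup>m\<close> on a set \<open>A\<^sub>m\<close> of positive finite measure.  As \<open>P \<omega>\<close> is bounded,
  almost every point lies in only finitely many \<open>A\<^sub>m\<close>, so infinitely many of the disjoint sets
  \<open>B\<^sub>m = A\<^sub>m - (\<Union>i>m. A\<^sub>i)\<close> still have positive measure.\<close>

lemma random_norm_bounded_if_preserves:
  assumes pres: "\<And>f. f \<in> K_direct_integral M sn K \<Longrightarrow> pointwise_op P f \<in> K_direct_integral M sn K"
  shows "\<exists>C\<ge>0. AE \<omega> in M. random_norm M sn P \<omega> \<le> ennreal C"
proof (rule ccontr)
  assume "\<not> ?thesis"
  then have no: "\<not> (AE \<omega> in M. random_norm M sn P \<omega> \<le> ennreal C)" if "0 \<le> C" for C
    using that by blast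
  define hump where "hump m v A \<longleftrightarrow> A \<in> sets M \<and> 0 < emeasure M A \<and> emeasure M A < \<infinity> \<and>
    (AE \<omega> in M. \<omega> \<in> A \<longrightarrow> 4 ^ m < op_quotient sn P v \<omega>)" for m :: nat and v A
  have "\<forall>m. \<exists>v A. hump m v A"
    unfolding hump_def by (intro allI random_norm_exceeds[OF fam op M] no) simp_all
  then obtain v A where "\<And>m. hump m (v m) (A m)" by metis
  then have A[measurable]: "\<And>m. A m \<in> sets M" and A_pos: "\<And>m. 0 < emeasure M (A m)"
    and A_fin: "\<And>m. emeasure M (A m) < \<infinity>"
    and A_exp: "\<And>m. AE \<omega> in M. \<omega> \<in> A m \<longrightarrow> 4 ^ m < op_quotient sn P (v m) \<omega>"
    by (simp_all add: hump_def)
  have AE_exp: "AE \<omega> in M. \<forall>m. \<omega> \<in> A m \<longrightarrow> 4 ^ m < op_quotient sn P (v m) \<omega>"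
    using A_exp by (simp only: AE_all_countable) blast
  have AE_fin: "AE \<omega> in M. finite {m. \<omega> \<in> A m}"
    using AE_exp AE_op_quotient_bounded
  proof eventually_elim
    case (elim \<omega>)
    then obtain C where C: "\<And>v. op_quotient sn P v \<omega> \<le> C" by blast
    \<comment> \<open>Membership in \<open>A m\<close> forces \<open>4 ^ m < C\<close>, so only
      indices below \<open>N\<close> can occur at this point.\<close>
    obtain N where N: "C < 4 ^ N" using real_arch_pow[of 4 C] by auto
    have "m < N" if "\<omega> \<in> A m" for m
    proof -
      have "4 ^ m < op_quotient sn P (v m) \<omega>" using elim(1) that by blast
      also have "\<dots> \<le> C" by (rule C)
      also note N
      finally show ?thesis by simp
    qed
    then have "{m. \<omega> \<in> A m} \<subseteq> {..<N}" by blast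
    then show ?case by (rule finite_subset) simp
  qed
  define B where "B m = A m - (\<Union>i\<in>{m<..}. A i)" for m
  have B[measurable]: "B m \<in> sets M" for m unfolding B_def by measurable
  have B_fin: "emeasure M (B m) < \<infinity>" for m
    using emeasure_mono[of "B m" "A m" M] A_fin[of m] by (auto simp: B_def)
  have disj: "disjoint_family B"
    unfolding disjoint_family_on_def
  proof safe
    fix m n :: nat and \<omega> assume "m \<noteq> n" "\<omega> \<in> B m" "\<omega> \<in> B n"
    then show "\<omega> \<in> {}" by (cases "m < n") (auto simp: B_def)
  qed
  \<comment> \<open>Almost every point of \<open>A n\<close> lies in \<open>B m\<close> for the last
    index \<open>m \<ge> n\<close> with the point in \<open>A m\<close>. If all these
    \<open>B m\<close> were null, so would be \<open>A n\<close>.\<close>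
  have B_pos: "\<exists>m\<ge>n. 0 < emeasure M (B m)" for n
  proof (rule ccontr)
    assume "\<not> ?thesis"
    then have "B m \<in> null_sets M" if "n \<le> m" for m
      using that by (intro null_setsI) (auto simp: zero_less_iff_neq_zero)
    then have "AE \<omega> in M. n \<le> m \<longrightarrow> \<omega> \<notin> B m" for m
      by (cases "n \<le> m") (auto intro: AE_not_in)
    then have "AE \<omega> in M. \<forall>m. n \<le> m \<longrightarrow> \<omega> \<notin> B m"
      by (simp only: AE_all_countable) blast
    with AE_fin have "AE \<omega> in M. \<omega> \<notin> A n"
    proof eventually_elim
      case (elim \<omega>)
      show ?case
      proof
        assume n: "\<omega> \<in> A n"
        define m where "m = Max {m. \<omega> \<in> A m}"
        have m: "\<omega> \<in> A m" "n \<le> m" and Max: "\<And>i. \<omega> \<in> A i \<Longrightarrow> i \<le> m"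
          using Max_in[OF elim(1)] n elim(1) by (auto simp: m_def)
        have "\<omega> \<notin> A i" if "m < i" for i
          using Max[of i] that by auto
        with m(1) have "\<omega> \<in> B m" by (simp add: B_def)
        with elim(2) m(2) show False by blast
      qed
    qed
    then have "emeasure M (A n) = 0"
      using AE_iff_measurable[OF A[of n], of "\<lambda>\<omega>. \<omega> \<notin> A n"] sets.sets_into_space[OF A[of n]] by auto
    with A_pos[of n] show False by simp
  qed
  \<comment> \<open>Scaled so that \<open>t m\<close> times the indicator has norm
    \<open>(1 / 2) ^ m\<close>. For a null \<open>B m\<close> the denominator is 0 and so is
    \<open>t m\<close>.\<close>
  define t where "t m = (1 / 2) ^ m / nK (indicator (B m))" for m
  have ind_nonneg: "0 \<le> nK (indicator (B m))" for m
    by (intro koethe_norm_nonneg[OF K] koethe_indicator[OF K] B B_fin)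
  then have t_nonneg: "0 \<le> t m" for m by (simp add: t_def)
  have "\<bar>t m\<bar> * nK (indicator (B m)) \<le> (1 / 2) ^ m" for m
    using ind_nonneg[of m] by (cases "nK (indicator (B m)) = 0") (simp_all add: t_def)
  then obtain u where u: "u \<in> K" and u_on: "\<And>m \<omega>. \<omega> \<in> B m \<Longrightarrow> u \<omega> = t m"
    and u_off: "\<And>\<omega>. (\<And>m. \<omega> \<notin> B m) \<Longrightarrow> u \<omega> = 0"
    using koethe_disjoint_sum[OF K B B_fin disj, of t] by blast
  have u_meas[measurable]: "u \<in> borel_measurable M" by (rule koethe_measurable[OF K u])
  \<comment> \<open>The index of the only piece containing the point. Off all pieces the value is
    unspecified and harmless, since \<open>u\<close> is 0 there.\<close>
  define n where "n \<omega> = (LEAST m. \<omega> \<in> B m)" for \<omega>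
  have n_meas: "n \<in> measurable M (count_space UNIV)" unfolding n_def[abs_def] by measurable
  have n: "n \<omega> = m" if "\<omega> \<in> B m" for m \<omega>
  proof -
    have "\<omega> \<in> B (n \<omega>)" unfolding n_def by (rule LeastI[of "\<lambda>m. \<omega> \<in> B m", OF that])
    with that disjoint_family_onD[OF disj, of "n \<omega>" m] show ?thesis by blast
  qed
  have B_A: "\<omega> \<in> B m \<Longrightarrow> \<omega> \<in> A m" for m \<omega> by (simp add: B_def)
  have supp: "AE \<omega> in M. u \<omega> \<noteq> 0 \<longrightarrow> sn \<omega> (v (n \<omega>)) \<noteq> 0"
    using AE_exp
  proof eventually_elim
    case (elim \<omega>)
    show ?case
    proof
      assume "u \<omega> \<noteq> 0"
      then obtain m where m: "\<omega> \<in> B m" using u_off by blast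
      then have "4 ^ m < op_quotient sn P (v m) \<omega>" using elim B_A by blast
      moreover have "0 < (4 ^ m :: real)" by simp
      ultimately show "sn \<omega> (v (n \<omega>)) \<noteq> 0"
        by (auto simp: n[OF m] op_quotient_def)
    qed
  qed
  define f where "f \<omega> = compl_emb (sn \<omega>) ((u \<omega> / sn \<omega> (v (n \<omega>))) *\<^sub>R v (n \<omega>))" for \<omega>
  note f = normalized_section[OF fam op u_meas n_meas supp, folded f_def]
  have "(\<lambda>\<omega>. \<bar>u \<omega>\<bar>) \<in> K" by (rule koethe_solid[OF K u]) simp_all
  then have "f \<in> K_direct_integral M sn K"
    using f(1,2) by (intro K_direct_integralI[OF K])
  from pres[OF this] obtain g where g: "g \<in> K" "AE \<omega> in M. compl_norm (sn \<omega>) (pointwise_op P f \<omega>) = g \<omega>"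
    using K_direct_integralE[OF K] by blast
  \<comment> \<open>Almost everywhere on \<open>B m\<close> the section has norm \<open>t m\<close>
    and \<open>P\<close> expands it by more than \<open>4 ^ m\<close>; monotonicity of
    \<open>nK\<close> carries this over to the norms.\<close>
  have bound: "4 ^ m * t m * nK (indicator (B m)) \<le> nK g" for m
  proof -
    have "AE \<omega> in M. \<bar>4 ^ m * t m * indicator (B m) \<omega>\<bar> \<le> \<bar>g \<omega>\<bar>"
      using g(2) f(3) AE_exp
    proof eventually_elim
      case (elim \<omega>)
      show ?case
      proof (cases "\<omega> \<in> B m")
        case True
        then have "4 ^ m \<le> op_quotient sn P (v m) \<omega>" using elim(3) B_A less_imp_le by blast
        then have "t m * 4 ^ m \<le> t m * op_quotient sn P (v m) \<omega>"
          using t_nonneg by (rule mult_left_mono)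
        moreover have "g \<omega> = t m * op_quotient sn P (v m) \<omega>"
          using elim(1,2) t_nonneg[of m] by (simp add: u_on[OF True] n[OF True])
        ultimately show ?thesis using True t_nonneg[of m] by (simp add: mult.commute)
      qed simp
    qed
    then have "nK (\<lambda>\<omega>. (4 ^ m * t m) * indicator (B m) \<omega>) \<le> nK g"
      by (intro koethe_mono[OF K g(1)]) auto
    then show ?thesis
      using koethe_norm_scale[OF K koethe_indicator[OF K B B_fin], of "4 ^ m * t m" m] t_nonneg[of m] by simp
  qed
  \<comment> \<open>For a non-null \<open>B m\<close> the left side of \<open>bound\<close> is
    \<open>4 ^ m * (1 / 2) ^ m = 2 ^ m\<close>, and such \<open>m\<close> exist beyond every
    \<open>N\<close>.\<close>
  obtain N where N: "nK g < 2 ^ N" using real_arch_pow[of 2 "nK g"] by auto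
  obtain m where m: "N \<le> m" "0 < emeasure M (B m)" using B_pos by blast
  have "0 < nK (indicator (B m))" by (rule koethe_indicator_norm_pos[OF K B B_fin m(2)])
  then have "4 ^ m * t m * nK (indicator (B m)) = 4 ^ m * (1 / 2) ^ m" by (simp add: t_def)
  also have "\<dots> = 2 ^ m" by (simp add: power_mult_distrib[symmetric])
  finally have "2 ^ m \<le> nK g" using bound[of m] by simp
  moreover have "(2::real) ^ N \<le> 2 ^ m" using m(1) by simp
  ultimately show False using N by linarith
qed

section \<open>The operator norm as essential supremum of the random norm\<close>

lemma K_norm_quotient_le:
  assumes C: "0 \<le> C" "AE \<omega> in M. random_norm M sn P \<omega> \<le> ennreal C"
    and f: "f \<in> K_direct_integral M sn K"
  shows "K_norm M sn K nK (pointwise_op P f) / K_norm M sn K nK f \<le> C"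
  using K_direct_integral_op_bound(2)[OF C f] K_norm_nonneg[OF K f] C(1)
  by (cases "K_norm M sn K nK f = 0") (simp_all add: divide_le_eq)

text \<open>A real \<open>SUP\<close> is an upper bound only of a set that is bounded above;
  \<open>C\<close> supplies such a bound.\<close>

lemma le_K_onorm:
  assumes C: "0 \<le> C" "AE \<omega> in M. random_norm M sn P \<omega> \<le> ennreal C"
    and f: "f \<in> K_direct_integral M sn K"
  shows "K_norm M sn K nK (pointwise_op P f) / K_norm M sn K nK f \<le> K_onorm M sn K nK (pointwise_op P)"
  unfolding K_onorm_def
proof (rule cSUP_upper[OF f], rule bdd_aboveI2)
  fix f assume "f \<in> K_direct_integral M sn K"
  then show "K_norm M sn K nK (pointwise_op P f) / K_norm M sn K nK f \<le> C" by (rule K_norm_quotient_le[OF C])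
qed

text \<open>Makes the index set of the supremum in \<open>K_onorm\<close> nonempty, which the
  estimate from above requires.\<close>

lemma zero_section_K: "(\<lambda>\<omega>. compl_emb (sn \<omega>) 0) \<in> K_direct_integral M sn K"
  using normalized_section(1,2)[OF fam op, of "\<lambda>_. 0" "\<lambda>_. 0" "\<lambda>_. 0"] koethe_zero[OF K]
  by (intro K_direct_integralI[OF K, where g="\<lambda>_. 0"]) simp_all

lemma K_onorm_le:
  assumes C: "0 \<le> C" "AE \<omega> in M. random_norm M sn P \<omega> \<le> ennreal C"
  shows "K_onorm M sn K nK (pointwise_op P) \<le> C"
  unfolding K_onorm_def
proof (rule cSUP_least)
  fix f assume "f \<in> K_direct_integral M sn K"
  then show "K_norm M sn K nK (pointwise_op P f) / K_norm M sn K nK f \<le> C" by (rule K_norm_quotient_le[OF C])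
qed (use zero_section_K in blast)

lemma K_onorm_nonneg:
  assumes C: "0 \<le> C" "AE \<omega> in M. random_norm M sn P \<omega> \<le> ennreal C"
  shows "0 \<le> K_onorm M sn K nK (pointwise_op P)"
proof -
  note z = zero_section_K
  have "0 \<le> K_norm M sn K nK (pointwise_op P (\<lambda>\<omega>. compl_emb (sn \<omega>) 0)) / K_norm M sn K nK (\<lambda>\<omega>. compl_emb (sn \<omega>) 0)"
    by (intro divide_nonneg_nonneg K_norm_nonneg[OF K] K_direct_integral_op_bound(1)[OF C] z)
  also have "\<dots> \<le> K_onorm M sn K nK (pointwise_op P)" by (rule le_K_onorm[OF C z])
  finally show ?thesis .
qed

text \<open>Otherwise some vector is expanded by more than \<open>c\<close> on a set
  \<open>A\<close> of positive finite measure. Its normalization, cut off to \<open>A\<close>, is a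
  section whose norm \<open>P\<close> multiplies by at least \<open>c\<close>.\<close>

lemma random_norm_le_K_onorm:
  assumes C: "0 \<le> C" "AE \<omega> in M. random_norm M sn P \<omega> \<le> ennreal C"
    and c: "K_onorm M sn K nK (pointwise_op P) < c"
  shows "AE \<omega> in M. random_norm M sn P \<omega> \<le> ennreal c"
proof (rule ccontr)
  assume no: "\<not> ?thesis"
  have c0: "0 \<le> c" using K_onorm_nonneg[OF C] c by simp
  obtain v A where A[measurable]: "A \<in> sets M" and A_meas: "0 < emeasure M A" "emeasure M A < \<infinity>"
    and exp: "AE \<omega> in M. \<omega> \<in> A \<longrightarrow> c < op_quotient sn P v \<omega>"
    using random_norm_exceeds[OF fam op M c0 no] by blast
  let ?u = "indicator A :: _ \<Rightarrow> real"
  note ind = koethe_indicator[OF K A A_meas(2)]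
  note pos = koethe_indicator_norm_pos[OF K A A_meas(2,1)]
  \<comment> \<open>Where the seminorm is 0 the quotient is 0 and cannot exceed the nonnegative
    \<open>c\<close>.\<close>
  have supp: "AE \<omega> in M. ?u \<omega> \<noteq> 0 \<longrightarrow> sn \<omega> v \<noteq> 0"
    using exp by eventually_elim (use c0 in \<open>auto simp: op_quotient_def indicator_def\<close>)
  define f where "f \<omega> = compl_emb (sn \<omega>) ((?u \<omega> / sn \<omega> v) *\<^sub>R v)" for \<omega>
  have "(\<lambda>_. 0::nat) \<in> measurable M (count_space UNIV)" by simp
  note f = normalized_section[OF fam op koethe_measurable[OF K ind] this, of "\<lambda>_. v", OF supp,
      folded f_def]
  have f_norm: "AE \<omega> in M. compl_norm (sn \<omega>) (f \<omega>) = ?u \<omega>"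
    using f(2) by simp
  have f_K: "f \<in> K_direct_integral M sn K"
    by (rule K_direct_integralI[OF K f(1) ind f_norm])
  obtain g where g: "g \<in> K" "AE \<omega> in M. compl_norm (sn \<omega>) (pointwise_op P f \<omega>) = g \<omega>"
    using K_direct_integralE[OF K K_direct_integral_op_bound(1)[OF C f_K]] by blast
  have "AE \<omega> in M. \<bar>c * ?u \<omega>\<bar> \<le> \<bar>g \<omega>\<bar>"
    using g(2) f(3) exp by eventually_elim (use c0 in \<open>auto simp: indicator_def\<close>)
  then have "nK (\<lambda>\<omega>. c * ?u \<omega>) \<le> nK g"
    by (intro koethe_mono[OF K g(1)]) auto
  then have "c * nK ?u \<le> nK g" using koethe_norm_scale[OF K ind, of c] c0 by simp
  then have "c \<le> nK g / nK ?u" using pos by (simp add: pos_le_divide_eq)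
  also have "\<dots> \<le> K_onorm M sn K nK (pointwise_op P)"
    using le_K_onorm[OF C f_K] by (simp add: K_norm_eq[OF K g] K_norm_eq[OF K ind f_norm])
  finally show False using c by simp
qed

lemma K_onorm_eq_esssup:
  assumes C: "0 \<le> C" "AE \<omega> in M. random_norm M sn P \<omega> \<le> ennreal C"
  shows "ennreal (K_onorm M sn K nK (pointwise_op P)) = esssup M (random_norm M sn P)"
proof (rule antisym)
  note meas = random_norm_measurable[OF fam op M]
  have "esssup M (random_norm M sn P) \<le> ennreal C" by (rule esssup_I[OF meas C(2)])
  then obtain D where D: "0 \<le> D" "esssup M (random_norm M sn P) = ennreal D"
    by (cases "esssup M (random_norm M sn P)") (auto simp: top_unique)
  have "AE \<omega> in M. random_norm M sn P \<omega> \<le> ennreal D"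
    using esssup_AE[of "random_norm M sn P" M] by (simp add: D(2))
  then show "ennreal (K_onorm M sn K nK (pointwise_op P)) \<le> esssup M (random_norm M sn P)"
    unfolding D(2) by (intro ennreal_leI K_onorm_le D(1))
  \<comment> \<open>The lower estimate is available for \<open>c\<close> strictly above the operator
    norm only; \<open>dense_ge\<close> then lets \<open>c\<close> decrease to it.\<close>
  have "D \<le> c" if "K_onorm M sn K nK (pointwise_op P) < c" for c
  proof -
    have "ennreal D \<le> ennreal c"
      unfolding D(2)[symmetric] by (rule esssup_I[OF meas random_norm_le_K_onorm[OF C that]])
    then show ?thesis using K_onorm_nonneg[OF C] that by (simp add: ennreal_le_iff)
  qed
  then have "D \<le> K_onorm M sn K nK (pointwise_op P)" by (rule dense_ge)
  then show "esssup M (random_norm M sn P) \<le> ennreal (K_onorm M sn K nK (pointwise_op P))"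
    unfolding D(2) by (rule ennreal_leI)
qed

lemma random_norm_in_L_infinity_iff:
  "random_norm M sn P \<in> L_infinity M \<longleftrightarrow> (\<exists>C\<ge>0. AE \<omega> in M. random_norm M sn P \<omega> \<le> ennreal C)"
proof
  assume "random_norm M sn P \<in> L_infinity M"
  then obtain C where "AE \<omega> in M. random_norm M sn P \<omega> \<le> ennreal C"
    by (auto simp: L_infinity_def)
  \<comment> \<open>The constant in \<open>L_infinity\<close> may be negative;
    \<open>ennreal\<close> maps it to 0 then, so \<open>max 0 C\<close> gives the same
    bound.\<close>
  then have "AE \<omega> in M. random_norm M sn P \<omega> \<le> ennreal (max 0 C)"
    by (rule eventually_mono) (auto simp: max_def ennreal_neg)
  then show "\<exists>C\<ge>0. AE \<omega> in M. random_norm M sn P \<omega> \<le> ennreal C"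
    by (intro exI[of _ "max 0 C"]) simp
next
  assume "\<exists>C\<ge>0. AE \<omega> in M. random_norm M sn P \<omega> \<le> ennreal C"
  then show "random_norm M sn P \<in> L_infinity M"
    using random_norm_measurable[OF fam op M] by (auto simp: L_infinity_def)
qed

end

theorem theorem3p5:
  fixes M :: "'w measure"
    and sn :: "'w \<Rightarrow> 'v::real_vector \<Rightarrow> real"
    and K :: "('w \<Rightarrow> real) set" and nK :: "('w \<Rightarrow> real) \<Rightarrow> real"
    and P :: "'w \<Rightarrow> (nat \<Rightarrow> 'v) set \<Rightarrow> (nat \<Rightarrow> 'v) set"
  assumes "localizable M"
    and "measurable_family M sn"
    and "koethe_space M K nK"
    and "measurable_operator_family M sn P"
  shows "((\<forall>f\<in>K_direct_integral M sn K. pointwise_op P f \<in> K_direct_integral M sn K)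
            \<longleftrightarrow> random_norm M sn P \<in> L_infinity M)
       \<and> (random_norm M sn P \<in> L_infinity M \<longrightarrow>
            bounded_operator_K M sn K nK (pointwise_op P)
            \<and> ennreal (K_onorm M sn K nK (pointwise_op P)) = esssup M (random_norm M sn P))"
proof (intro conjI iffI impI)
  note iff = random_norm_in_L_infinity_iff[OF assms]
  {
    assume "\<forall>f\<in>K_direct_integral M sn K. pointwise_op P f \<in> K_direct_integral M sn K"
    then show "random_norm M sn P \<in> L_infinity M"
      unfolding iff by (intro random_norm_bounded_if_preserves[OF assms]) blast
  next
    assume "random_norm M sn P \<in> L_infinity M"
    then obtain C where C: "0 \<le> C" "AE \<omega> in M. random_norm M sn P \<omega> \<le> ennreal C"
      unfolding iff by blast
    show "\<forall>f\<in>K_direct_integral M sn K. pointwise_op P f \<in> K_direct_integral M sn K"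
      by (intro ballI K_direct_integral_op_bound(1)[OF assms C])
    show "bounded_operator_K M sn K nK (pointwise_op P)"
      by (rule bounded_operator_K_pointwise_op[OF assms C])
    show "ennreal (K_onorm M sn K nK (pointwise_op P)) = esssup M (random_norm M sn P)"
      by (rule K_onorm_eq_esssup[OF assms C])
  }
qed

end
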